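(* Let $m,n,r,s,\lambda$ be positive integers with $n>m\geq 4$, and suppose that if $m=4$ then $\lambda\geq 2$ and $r\geq 2$. Suppose that $r\binom{n-1}{3}>s\binom{m-1}{3}$, and let an $r$-factorization of $\lambda K_m^4$ be given. Then this $r$-factorization of $\lambda K_m^4$ can be extended to an $s$-factorization of $\lambda K_n^4$ if and only if all of the following conditions hold: (1) $4\mid rm$, $4\mid sn$, $r\mid \lambda\binom{m-1}{3}$, $s\mid\lambda\binom{n-1}{3}$, and $1\leq \dfrac{s}{r}\leq \binom{n-1}{3}\Big/\binom{m-1}{3}$; (2) $n\geq 2m$ if $s=r$, and $n\geq \dfrac{4m}{3}$ if $s>r$; (3) $(n-m)\binom{m}{3}\geq \left(m-\dfrac{n}{2}\right)\left[\binom{n-1}{3}-\dfrac{s}{r}\binom{m-1}{3}\right]$; (4) $2(n-m)\binom{m}{3}+\binom{m}{2}\binom{n-m}{2}\geq \left(m-\dfrac{n}{4}\right)\left[\binom{n-1}{3}-\dfrac{s}{r}\binom{m-1}{3}\right]$.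
   Context: For positive integers $m,h,\lambda$, $\lambda K_m^h$ denotes the collection of all $h$-subsets (called edges) of the vertex set $[m]=\{1,\dots,m\}$, where each $h$-subset occurs $\lambda$ times (the $\lambda$ copies are regarded as distinct edges). A $q$-coloring of $\lambda K_m^h$ is a map from its edges to $[q]$; the edges mapped to $j\in[q]$ form color class $j$. The degree of a vertex in a color class is the number of edges of that color class containing it. An $r$-factorization of $\lambda K_m^h$ is a coloring (with some number $q$ of colors) such that in every color class every vertex of $[m]$ has degree exactly $r$. For $n>m$, $\lambda K_m^h$ is regarded as the subcollection of $\lambda K_n^h$ consisting of all edges contained in $[m]$. An $r$-factorization of $\lambda K_m^h$ can be extended to an $s$-factorization of $\lambda K_n^h$ if there is an $s$-factorization of $\lambda K_n^h$, whose set of colors contains the set of colors of the $r$-factorization, in which every edge of $\lambda K_m^h$ has the same color as in the $r$-factorization. *)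

theory Defs
  imports Complex_Main "HOL-Library.FuncSet"
begin

text \<open>
  An edge of \<open>\<lambda>K\<^sub>m\<^sup>h\<close> is a pair of an \<open>h\<close>-subset of \<open>{1..m}\<close> and a copy number in \<open>{1..\<lambda>}\<close>, so
  that the \<open>\<lambda>\<close> copies are distinct edges and, for \<open>m \<le> n\<close>, \<open>\<lambda>K\<^sub>m\<^sup>h\<close> is literally a subset of
  \<open>\<lambda>K\<^sub>n\<^sup>h\<close>.
\<close>

type_synonym edge = "nat set \<times> nat"

definition complete_edges :: "nat \<Rightarrow> nat \<Rightarrow> nat \<Rightarrow> edge set" where
  "complete_edges lam m h = {A. A \<subseteq> {1..m} \<and> card A = h} \<times> {1..lam}"

text \<open>Only the values of a coloring on the edges matter; it is arbitrary elsewhere.\<close>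

definition coloring :: "nat \<Rightarrow> nat \<Rightarrow> nat \<Rightarrow> nat \<Rightarrow> (edge \<Rightarrow> nat) \<Rightarrow> bool" where
  "coloring lam m h q f \<longleftrightarrow> f \<in> complete_edges lam m h \<rightarrow> {1..q}"

definition color_class :: "nat \<Rightarrow> nat \<Rightarrow> nat \<Rightarrow> (edge \<Rightarrow> nat) \<Rightarrow> nat \<Rightarrow> edge set" where
  "color_class lam m h f j = {e \<in> complete_edges lam m h. f e = j}"

definition degree :: "edge set \<Rightarrow> nat \<Rightarrow> nat" where
  "degree E v = card {e \<in> E. v \<in> fst e}"

definition factorization ::
  "nat \<Rightarrow> nat \<Rightarrow> nat \<Rightarrow> nat \<Rightarrow> nat \<Rightarrow> (edge \<Rightarrow> nat) \<Rightarrow> bool" where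
  "factorization r lam m h q f \<longleftrightarrow>
     coloring lam m h q f \<and>
     (\<forall>j\<in>{1..q}. \<forall>v\<in>{1..m}. degree (color_class lam m h f j) v = r)"

text \<open>
  The coloring \<open>f\<close> of \<open>\<lambda>K\<^sub>m\<^sup>h\<close> with color set \<open>{1..q}\<close> extends to an \<open>s\<close>-factorization of \<open>\<lambda>K\<^sub>n\<^sup>h\<close>.
\<close>

definition extends_to_factorization ::
  "nat \<Rightarrow> nat \<Rightarrow> nat \<Rightarrow> nat \<Rightarrow> nat \<Rightarrow> nat \<Rightarrow> (edge \<Rightarrow> nat) \<Rightarrow> bool" where
  "extends_to_factorization s lam n m h q f \<longleftrightarrow>
     (\<exists>q' g. {1..q} \<subseteq> {1..q'} \<and> factorization s lam n h q' g \<and>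
        (\<forall>e \<in> complete_edges lam m h. g e = f e))"

end

theory Submission
  imports Defs
begin

text \<open>
  Write \<open>p = n - m\<close>, let \<open>q'\<close> be the number \<open>lam * ((n - 1) choose 3) / s\<close> of colors of an
  \<open>s\<close>-factorization of \<open>\<lambda>K\<^sub>n\<^sup>4\<close>, and let the type of an edge of \<open>\<lambda>K\<^sub>n\<^sup>4\<close> be the number \<open>a\<close> of its
  vertices in \<open>[m]\<close>. The edges of type 4 have their colors already, so only types 0 to 3 are to be
  colored; there are \<open>T a = lam * (m choose a) * (p choose (4 - a))\<close> edges of type \<open>a\<close>.

  The key point is that only the numbers \<open>e j a\<close> of new edges of color \<open>j\<close> and type \<open>a\<close> matter.
  They satisfy three families of linear equations: color \<open>j\<close> must have \<open>E j\<close> new edges, these must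
  contribute \<open>D j\<close> to the degrees in \<open>[m]\<close> (where the \<open>q\<close> old colors lack \<open>s - r\<close> at each vertex
  and the others lack \<open>s\<close>), and the numbers of type \<open>a\<close> must add up to \<open>T a\<close>. Conversely every
  solution in natural numbers comes from an extension (\<open>extension_if_edge_split\<close>): collapse \<open>[m]\<close>
  and the set of new vertices to one vertex each, color the collapsed edges according to \<open>e\<close>, and
  pull the vertices apart again one at a time, keeping all degrees and multiplicities in
  proportion. As in Baranyai's theorem, the proportional division is a fractional solution of a
  bipartite assignment problem, which can therefore be solved in integers (\<open>integral_assignment\<close>,
  a consequence of Hall's theorem; \<open>detachment\<close>).

  This leaves an arithmetic question. Eliminating \<open>e j 0\<close> and \<open>e j 1\<close>, one must choose
  \<open>x j = e j 3\<close> and \<open>y j = e j 2\<close> with given sums, such that \<open>3 x + 2 y \<le> D\<close> and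
  \<open>2 x + y \<ge> D - E\<close>. A solution has \<open>e j 3 \<ge> D j - 2 * E j\<close> and
  \<open>2 * e j 3 + e j 2 \<ge> D j - E j\<close>; summed over the new colors \<open>j > q\<close>, these are the two
  inequalities that end the list of conditions, while \<open>D j \<le> 3 * E j\<close> for a new color means
  \<open>3 * n \<ge> 4 * m\<close>. If \<open>s = r\<close>, all new edges of an old color have type 0, and
  counting those gives \<open>n \<ge> 2 * m\<close>. For sufficiency, the numbers \<open>x j\<close> are chosen all below or all
  above the threshold \<open>(D j - E j) / 2\<close>, from which on the lower bound for \<open>y j\<close> is vacuous; then
  \<open>y\<close> fits up to rounding errors of at most one per color (\<open>edge_split_exists\<close>). The rounding is harmless because the numbers \<open>T a\<close> of edges are large
  compared with the number \<open>q'\<close> of colors, except in some cases in which parity helps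
  (\<open>edge_split_if_conditions\<close>). This works directly if \<open>n \<ge> 2 * m\<close>; if \<open>n < 2 * m\<close>, the same
  argument is applied after exchanging the roles of the types \<open>a\<close> and \<open>3 - a\<close>.
\<close>

section \<open>Integral assignments\<close>

text \<open>
  Hall's marriage theorem with a capacity for every \<open>b\<close>, by the argument of Halmos and Vaughan:
  if some proper nonempty \<open>S\<close> uses up the whole capacity of its neighbours, then \<open>S\<close> and its
  complement can be treated separately; otherwise there is slack to assign one element arbitrarily.
\<close>

lemma hall_capacities:
  fixes N :: "'a \<Rightarrow> 'b set" and c :: "'b \<Rightarrow> nat"
  assumes "finite U" and "\<And>e. e \<in> U \<Longrightarrow> finite (N e)"
    and "\<And>S. S \<subseteq> U \<Longrightarrow> card S \<le> sum c (\<Union>e\<in>S. N e)"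
  shows "\<exists>\<phi>. (\<forall>e\<in>U. \<phi> e \<in> N e) \<and> (\<forall>b. card {e\<in>U. \<phi> e = b} \<le> c b)"
  using assms
proof (induction "card U" arbitrary: U c rule: less_induct)
  case less
  note finU = less.prems(1) and finN = less.prems(2) and hall = less.prems(3)
  have finNS: "finite (\<Union>e\<in>S. N e)" if "S \<subseteq> U" for S
    using that finU finN finite_subset by (intro finite_UN_I) auto
  show ?case
  proof (cases "U = {}")
    case True
    then show ?thesis by auto
  next
    case nonempty: False
    show ?thesis
    proof (cases "\<exists>S. S \<subset> U \<and> S \<noteq> {} \<and> sum c (\<Union>e\<in>S. N e) \<le> card S")
      case True
      then obtain S where S: "S \<subset> U" "S \<noteq> {}" "sum c (\<Union>e\<in>S. N e) \<le> card S"
        by blast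
      let ?NS = "\<Union>e\<in>S. N e"
      have finS: "finite S" using S(1) finU by (meson finite_subset psubset_imp_subset)
      have "\<exists>\<phi>. (\<forall>e\<in>S. \<phi> e \<in> N e) \<and> (\<forall>b. card {e\<in>S. \<phi> e = b} \<le> c b)"
      proof (rule less.hyps)
        show "card S < card U" using S(1) finU by (simp add: psubset_card_mono)
        show "card T \<le> sum c (\<Union>e\<in>T. N e)" if "T \<subseteq> S" for T
          using that S(1) by (intro hall) auto
      qed (use S(1) finS finN in auto)
      then obtain \<phi>1 where \<phi>1: "\<And>e. e \<in> S \<Longrightarrow> \<phi>1 e \<in> N e"
        "\<And>b. card {e\<in>S. \<phi>1 e = b} \<le> c b" by blast
      define c' where "c' = (\<lambda>b. if b \<in> ?NS then 0 else c b)"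
      have "\<exists>\<phi>. (\<forall>e\<in>U - S. \<phi> e \<in> N e) \<and> (\<forall>b. card {e\<in>U - S. \<phi> e = b} \<le> c' b)"
      proof (rule less.hyps)
        have "U - S \<subset> U" using S by auto
        then show "card (U - S) < card U" using finU by (simp add: psubset_card_mono)
        show "card T \<le> sum c' (\<Union>e\<in>T. N e)" if T: "T \<subseteq> U - S" for T
        proof -
          let ?NT = "\<Union>e\<in>T. N e"
          have fT: "finite T" using T finU finite_subset by blast
          have fNT: "finite ?NT" and fNS: "finite ?NS" using T S(1) by (auto intro!: finNS)
          have "card T + card S = card (S \<union> T)"
            using T finS fT by (subst card_Un_disjoint) auto
          also have "\<dots> \<le> sum c (\<Union>e\<in>S \<union> T. N e)" using T S(1) by (intro hall) auto
          also have "(\<Union>e\<in>S \<union> T. N e) = ?NS \<union> (?NT - ?NS)" by auto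
          also have "sum c \<dots> = sum c ?NS + sum c (?NT - ?NS)"
            using fNT fNS by (subst sum.union_disjoint) auto
          also have "sum c (?NT - ?NS) = sum c' ?NT"
            using fNT by (auto intro!: sum.mono_neutral_cong_left simp: c'_def split: if_splits)
          finally show ?thesis using S(3) by linarith
        qed
      qed (use finU finN in auto)
      then obtain \<phi>2 where \<phi>2: "\<And>e. e \<in> U - S \<Longrightarrow> \<phi>2 e \<in> N e"
        "\<And>b. card {e\<in>U - S. \<phi>2 e = b} \<le> c' b" by blast
      define \<phi> where "\<phi> = (\<lambda>e. if e \<in> S then \<phi>1 e else \<phi>2 e)"
      have "card {e\<in>U. \<phi> e = b} \<le> c b" for b
      proof -
        have "{e\<in>U. \<phi> e = b} = {e\<in>S. \<phi>1 e = b} \<union> {e\<in>U - S. \<phi>2 e = b}"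
          using S(1) by (auto simp: \<phi>_def)
        then have le: "card {e\<in>U. \<phi> e = b} \<le> card {e\<in>S. \<phi>1 e = b} + card {e\<in>U - S. \<phi>2 e = b}"
          by (simp add: card_Un_le)
        show ?thesis
        proof (cases "b \<in> ?NS")
          case True
          then have "card {e\<in>U - S. \<phi>2 e = b} \<le> 0" using \<phi>2(2)[of b] by (simp add: c'_def)
          then show ?thesis using le \<phi>1(2)[of b] by linarith
        next
          case False
          then have "{e\<in>S. \<phi>1 e = b} = {}" using \<phi>1(1) by auto
          then have "card {e\<in>S. \<phi>1 e = b} = 0" by (simp only: card.empty)
          moreover have "c' b = c b" using False by (simp add: c'_def)
          ultimately show ?thesis using le \<phi>2(2)[of b] by linarith
        qed
      qed
      moreover have "\<forall>e\<in>U. \<phi> e \<in> N e" using \<phi>1 \<phi>2 by (auto simp: \<phi>_def)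
      ultimately show ?thesis by blast
    next
      case False
      then have slack: "card S < sum c (\<Union>e\<in>S. N e)" if "S \<subset> U" "S \<noteq> {}" for S
        using that by (meson not_less)
      obtain e where e: "e \<in> U" using nonempty by auto
      have "card {e} \<le> sum c (N e)" using hall[of "{e}"] e by simp
      then have "sum c (N e) \<noteq> 0" by simp
      then obtain b where b: "b \<in> N e" "c b > 0" by (meson gr0I sum.neutral)
      define c' where "c' = c(b := c b - 1)"
      have "\<exists>\<phi>. (\<forall>x\<in>U - {e}. \<phi> x \<in> N x) \<and> (\<forall>y. card {x\<in>U - {e}. \<phi> x = y} \<le> c' y)"
      proof (rule less.hyps)
        show "card (U - {e}) < card U" using finU e by (rule card_Diff1_less)
        show "card T \<le> sum c' (\<Union>x\<in>T. N x)" if T: "T \<subseteq> U - {e}" for T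
        proof (cases "T = {}")
          case False
          let ?NT = "\<Union>x\<in>T. N x"
          have fNT: "finite ?NT" using T by (intro finNS) auto
          have "T \<subset> U" using T e by auto
          then have "card T < sum c ?NT" using slack False by simp
          also have "sum c ?NT \<le> sum c' ?NT + 1"
          proof (cases "b \<in> ?NT")
            case True
            have "sum c ?NT = c b + sum c (?NT - {b})" using fNT True by (simp add: sum.remove)
            moreover have "sum c' ?NT = c' b + sum c' (?NT - {b})"
              using fNT True by (simp add: sum.remove)
            moreover have "sum c' (?NT - {b}) = sum c (?NT - {b})"
              by (intro sum.cong) (auto simp: c'_def)
            ultimately show ?thesis using b(2) by (simp add: c'_def)
          next
            case False
            then have "sum c' ?NT = sum c ?NT" by (intro sum.cong) (auto simp: c'_def)
            then show ?thesis by simp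
          qed
          finally show ?thesis by simp
        qed simp
      qed (use finU finN in auto)
      then obtain \<phi> where \<phi>: "\<And>x. x \<in> U - {e} \<Longrightarrow> \<phi> x \<in> N x"
        "\<And>y. card {x\<in>U - {e}. \<phi> x = y} \<le> c' y" by blast
      have "card {x\<in>U. (\<phi>(e := b)) x = y} \<le> c y" for y
      proof (cases "y = b")
        case True
        then have "{x\<in>U. (\<phi>(e := b)) x = y} = insert e {x\<in>U - {e}. \<phi> x = y}" using e by auto
        then have "card {x\<in>U. (\<phi>(e := b)) x = y} = Suc (card {x\<in>U - {e}. \<phi> x = y})"
          using finU by simp
        then show ?thesis using \<phi>(2)[of y] True b(2) by (simp add: c'_def)
      next
        case False
        then have "{x\<in>U. (\<phi>(e := b)) x = y} = {x\<in>U - {e}. \<phi> x = y}" by auto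
        then show ?thesis using \<phi>(2)[of y] False by (simp add: c'_def)
      qed
      moreover have "\<forall>x\<in>U. (\<phi>(e := b)) x \<in> N x" using \<phi>(1) b(1) by auto
      ultimately show ?thesis by blast
    qed
  qed
qed

text \<open>
  A fractional assignment with integral loads can be rounded: the weights \<open>\<mu>\<close> witness Hall's
  condition for the bipartite graph of positive weights, and as the capacities add up to the number
  of elements, none of them can be missed.
\<close>

lemma integral_assignment:
  fixes \<mu> :: "'a \<Rightarrow> 'b \<Rightarrow> real" and c :: "'b \<Rightarrow> nat"
  assumes fin: "finite U" "finite B"
    and nonneg: "\<And>e b. e \<in> U \<Longrightarrow> b \<in> B \<Longrightarrow> 0 \<le> \<mu> e b"
    and total: "\<And>e. e \<in> U \<Longrightarrow> (\<Sum>b\<in>B. \<mu> e b) = 1"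
    and load: "\<And>b. b \<in> B \<Longrightarrow> (\<Sum>e\<in>U. \<mu> e b) = c b"
  obtains \<phi> where "\<And>e. e \<in> U \<Longrightarrow> \<phi> e \<in> B \<and> \<mu> e (\<phi> e) > 0"
    and "\<And>b. b \<in> B \<Longrightarrow> card {e\<in>U. \<phi> e = b} = c b"
proof -
  define N where "N = (\<lambda>e. {b\<in>B. \<mu> e b > 0})"
  have "card S \<le> sum c (\<Union>e\<in>S. N e)" if S: "S \<subseteq> U" for S
  proof -
    let ?NS = "\<Union>e\<in>S. N e"
    have NSB: "?NS \<subseteq> B" by (auto simp: N_def)
    have "real (card S) = (\<Sum>e\<in>S. \<Sum>b\<in>B. \<mu> e b)"
      using S total by (simp add: subset_iff)
    also have "\<dots> = (\<Sum>e\<in>S. \<Sum>b\<in>?NS. \<mu> e b)"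
    proof (rule sum.cong[OF refl])
      fix e assume "e \<in> S"
      then have "\<forall>b\<in>B - ?NS. \<mu> e b = 0" using S nonneg by (force simp: N_def)
      then show "(\<Sum>b\<in>B. \<mu> e b) = (\<Sum>b\<in>?NS. \<mu> e b)"
        using fin NSB by (intro sum.mono_neutral_right)
    qed
    also have "\<dots> = (\<Sum>b\<in>?NS. \<Sum>e\<in>S. \<mu> e b)" by (rule sum.swap)
    also have "\<dots> \<le> (\<Sum>b\<in>?NS. \<Sum>e\<in>U. \<mu> e b)"
      using S fin NSB nonneg by (intro sum_mono sum_mono2) auto
    also have "\<dots> = (\<Sum>b\<in>?NS. real (c b))" using NSB load by (intro sum.cong) auto
    finally show ?thesis by (metis of_nat_le_iff of_nat_sum)
  qed
  then obtain \<phi> where \<phi>: "\<And>e. e \<in> U \<Longrightarrow> \<phi> e \<in> N e" "\<And>b. card {e\<in>U. \<phi> e = b} \<le> c b"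
    using hall_capacities[of U N c] fin by (auto simp: N_def)
  have "real (sum c B) = (\<Sum>b\<in>B. \<Sum>e\<in>U. \<mu> e b)" using load by simp
  also have "\<dots> = (\<Sum>e\<in>U. \<Sum>b\<in>B. \<mu> e b)" by (rule sum.swap)
  also have "\<dots> = real (card U)" using total by simp
  finally have cB: "sum c B = card U" by (simp only: of_nat_eq_iff)
  have "card U = (\<Sum>b\<in>B. card {e\<in>U. \<phi> e = b})"
    using \<phi>(1) fin unfolding card_eq_sum
    by (subst sum.group[of U B \<phi>]) (auto simp: N_def)
  then have "(\<Sum>b\<in>B. card {e\<in>U. \<phi> e = b}) = sum c B" using cB by simp
  then have "card {e\<in>U. \<phi> e = b} = c b" if "b \<in> B" for b
    using sum_mono_inv[of "\<lambda>b. card {e\<in>U. \<phi> e = b}" B c b] \<phi>(2) that fin by simp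
  then show thesis using that \<phi>(1) by (auto simp: N_def)
qed

section \<open>Detaching amalgamated vertices\<close>

text \<open>
  The step of Baranyai's argument. An edge \<open>e\<close> has \<open>\<beta> (\<kappa> e)\<close> of its vertices still amalgamated
  into a point that stands for \<open>Suc N\<close> vertices; \<open>Z\<close> is the set of edges that will contain the
  vertex split off next. The fair share of that vertex is the fraction \<open>\<beta> (\<kappa> e) / Suc N\<close> of
  each edge. To prescribe the number of chosen edges both in every class of \<open>\<kappa>\<close> and in every
  color, \<open>e\<close> is assigned to its class (chosen) or to its color (not chosen).
\<close>

lemma detach_one_vertex:
  fixes \<kappa> :: "'e \<Rightarrow> 'k" and col :: "'e \<Rightarrow> 'c" and \<beta> M :: "'k \<Rightarrow> nat" and d :: "'c \<Rightarrow> nat"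
  assumes fin: "finite U"
    and count: "\<And>k. card {e\<in>U. \<kappa> e = k} = M k * (Suc N choose \<beta> k)"
    and degree: "\<And>j. (\<Sum>e | e \<in> U \<and> col e = j. \<beta> (\<kappa> e)) = d j * Suc N"
  obtains Z where "Z \<subseteq> U"
    and "\<And>k. card {e\<in>Z. \<kappa> e = k} = (if \<beta> k = 0 then 0 else M k * (N choose (\<beta> k - 1)))"
    and "\<And>k. card {e\<in>U - Z. \<kappa> e = k} = M k * (N choose \<beta> k)"
    and "\<And>j. card {e\<in>Z. col e = j} = d j"
proof -
  define B :: "('c + 'k) set" where "B = Inl ` col ` U \<union> Inr ` \<kappa> ` U"
  define \<mu> :: "'e \<Rightarrow> 'c + 'k \<Rightarrow> real" where "\<mu> = (\<lambda>e y. case y of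
      Inl j \<Rightarrow> (if col e = j then 1 - real (\<beta> (\<kappa> e)) / Suc N else 0)
    | Inr k \<Rightarrow> (if \<kappa> e = k then real (\<beta> k) / Suc N else 0))"
  define w where "w = (\<lambda>k. if \<beta> k = 0 then 0 else M k * (N choose (\<beta> k - 1)))"
  define c :: "'c + 'k \<Rightarrow> nat" where "c = (\<lambda>y. case y of
      Inl j \<Rightarrow> card {e\<in>U. col e = j} - d j | Inr k \<Rightarrow> w k)"
  have \<beta>_le: "\<beta> (\<kappa> e) \<le> Suc N" if "e \<in> U" for e
  proof (rule ccontr)
    assume "\<not> \<beta> (\<kappa> e) \<le> Suc N"
    then have "card {e'\<in>U. \<kappa> e' = \<kappa> e} = 0" using count[of "\<kappa> e"] by (simp add: binomial_eq_0)
    then show False using that fin by auto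
  qed
  have d_le: "d j \<le> card {e\<in>U. col e = j}" for j
  proof -
    have "d j * Suc N \<le> (\<Sum>e | e \<in> U \<and> col e = j. Suc N)"
      unfolding degree[symmetric] using \<beta>_le by (intro sum_mono) auto
    also have "\<dots> = card {e\<in>U. col e = j} * Suc N" by simp
    finally show ?thesis by (metis mult_le_cancel2 zero_less_Suc)
  qed
  have w_eq: "real (w k) = real (card {e\<in>U. \<kappa> e = k}) * (real (\<beta> k) / Suc N)" for k
  proof (cases "\<beta> k")
    case (Suc b)
    have "real (Suc b) * real (Suc N choose Suc b) = real (Suc N) * real (N choose b)"
      by (metis Suc_times_binomial of_nat_mult)
    then show ?thesis unfolding count w_def Suc by (simp add: field_simps del: binomial_Suc_Suc)
  qed (simp add: w_def)
  have finB: "finite B" using fin by (simp add: B_def)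
  have "\<exists>\<phi>. (\<forall>e\<in>U. \<phi> e \<in> B \<and> \<mu> e (\<phi> e) > 0) \<and> (\<forall>y\<in>B. card {e\<in>U. \<phi> e = y} = c y)"
  proof -
    have total: "(\<Sum>y\<in>B. \<mu> e y) = 1" if "e \<in> U" for e
    proof -
      have "(\<Sum>y\<in>B. \<mu> e y) = (\<Sum>j\<in>col ` U. \<mu> e (Inl j)) + (\<Sum>k\<in>\<kappa> ` U. \<mu> e (Inr k))"
        unfolding B_def using fin by (subst sum.union_disjoint) (auto simp: sum.reindex)
      then show ?thesis using that fin by (simp add: \<mu>_def)
    qed
    have load: "(\<Sum>e\<in>U. \<mu> e y) = c y" if "y \<in> B" for y
    proof (cases y)
      case (Inl j)
      have "(\<Sum>e\<in>U. \<mu> e y) = (\<Sum>e | e \<in> U \<and> col e = j. 1 - real (\<beta> (\<kappa> e)) / Suc N)"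
        unfolding \<mu>_def Inl using fin by (simp add: sum.inter_filter del: of_nat_Suc)
      also have "\<dots> = real (card {e\<in>U. col e = j})
          - real (\<Sum>e | e \<in> U \<and> col e = j. \<beta> (\<kappa> e)) / Suc N"
        by (simp add: sum_subtractf sum_divide_distrib)
      also have "\<dots> = real (card {e\<in>U. col e = j}) - real (d j)"
        unfolding degree of_nat_mult by (simp del: of_nat_Suc)
      finally show ?thesis using d_le[of j] by (simp add: c_def Inl of_nat_diff)
    next
      case (Inr k)
      have "(\<Sum>e\<in>U. \<mu> e y) = (\<Sum>e | e \<in> U \<and> \<kappa> e = k. real (\<beta> k) / Suc N)"
        unfolding \<mu>_def Inr using fin by (subst sum.inter_filter) (simp_all del: of_nat_Suc)
      also have "\<dots> = real (w k)" unfolding w_eq by simp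
      finally show ?thesis by (simp add: c_def Inr)
    qed
    have nonneg: "0 \<le> \<mu> e y" if "e \<in> U" for e y
      using \<beta>_le[OF that] by (auto simp: \<mu>_def split: sum.splits)
    show ?thesis
      by (rule integral_assignment[OF fin finB nonneg total load]) auto
  qed
  then obtain \<phi> where \<phi>B: "\<And>e. e \<in> U \<Longrightarrow> \<phi> e \<in> B"
    and \<phi>pos: "\<And>e. e \<in> U \<Longrightarrow> \<mu> e (\<phi> e) > 0"
    and \<phi>card: "\<And>y. y \<in> B \<Longrightarrow> card {e\<in>U. \<phi> e = y} = c y" by blast
  define Z where "Z = {e\<in>U. \<phi> e = Inr (\<kappa> e)}"
  have \<phi>_cases: "\<phi> e = Inr (\<kappa> e) \<or> \<phi> e = Inl (col e)" if "e \<in> U" for e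
    using \<phi>pos[OF that] by (auto simp: \<mu>_def split: sum.splits if_splits)
  show thesis
  proof
    show "Z \<subseteq> U" by (auto simp: Z_def)
    show Zk: "card {e\<in>Z. \<kappa> e = k} = (if \<beta> k = 0 then 0 else M k * (N choose (\<beta> k - 1)))" for k
    proof (cases "k \<in> \<kappa> ` U")
      case True
      have "{e\<in>Z. \<kappa> e = k} = {e\<in>U. \<phi> e = Inr k}"
        by (auto simp: Z_def dest: \<phi>_cases)
      then have "card {e\<in>Z. \<kappa> e = k} = w k"
        using \<phi>card[of "Inr k"] True by (simp add: B_def c_def)
      then show ?thesis by (simp add: w_def)
    next
      case False
      then have "{e\<in>Z. \<kappa> e = k} = {}" and "{e\<in>U. \<kappa> e = k} = {}" by (auto simp: Z_def)
      then have "card {e\<in>Z. \<kappa> e = k} = 0" and "card {e\<in>U. \<kappa> e = k} = 0"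
        by (simp_all only: card.empty)
      then show ?thesis using w_eq[of k] unfolding w_def by simp
    qed
    show "card {e\<in>U - Z. \<kappa> e = k} = M k * (N choose \<beta> k)" for k
    proof -
      have "{e\<in>U. \<kappa> e = k} = {e\<in>Z. \<kappa> e = k} \<union> {e\<in>U - Z. \<kappa> e = k}" by (auto simp: Z_def)
      then have "card {e\<in>U. \<kappa> e = k} = card {e\<in>Z. \<kappa> e = k} + card {e\<in>U - Z. \<kappa> e = k}"
        using fin \<open>Z \<subseteq> U\<close>
        by (simp only:) (subst card_Un_disjoint; auto intro: finite_subset)
      then show ?thesis unfolding count Zk
        by (cases "\<beta> k") (simp_all add: algebra_simps)
    qed
    show "card {e\<in>Z. col e = j} = d j" for j
    proof (cases "j \<in> col ` U")
      case True
      have "{e\<in>U. \<phi> e = Inl j} = {e\<in>U. col e = j} - {e\<in>Z. col e = j}"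
        by (auto simp: Z_def dest: \<phi>_cases)
      then have "card {e\<in>U. \<phi> e = Inl j} = card {e\<in>U. col e = j} - card {e\<in>Z. col e = j}"
        using fin by (subst card_Diff_subset[symmetric]) (auto simp: Z_def)
      moreover have "card {e\<in>U. \<phi> e = Inl j} = card {e\<in>U. col e = j} - d j"
        using \<phi>card[of "Inl j"] True by (simp add: B_def c_def)
      moreover have "card {e\<in>Z. col e = j} \<le> card {e\<in>U. col e = j}"
        using fin by (intro card_mono) (auto simp: Z_def)
      ultimately show ?thesis using d_le[of j] by linarith
    next
      case False
      then have "{e\<in>Z. col e = j} = {}" and "{e\<in>U. col e = j} = {}" by (auto simp: Z_def)
      then have "card {e\<in>Z. col e = j} = 0" and "card {e\<in>U. col e = j} = 0"
        by (simp_all only: card.empty)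
      then show ?thesis using d_le[of j] by linarith
    qed
  qed
qed

text \<open>
  Splitting off the vertices of \<open>W\<close> one after the other preserves the proportions: what remains
  to be distributed is always of the form that the previous lemma requires, with the pairs of a label and
  the set of vertices already received as classes, since each vertex uses up its share \<open>d j\<close> of the
  degree in color \<open>j\<close>.
\<close>

theorem detachment:
  fixes lab :: "'e \<Rightarrow> 'x" and col :: "'e \<Rightarrow> 'c" and b L :: "'x \<Rightarrow> nat" and d :: "'c \<Rightarrow> nat"
    and W :: "'v set"
  assumes finU: "finite U" and finW: "finite W"
    and count: "\<And>x. card {e\<in>U. lab e = x} = L x * (card W choose b x)"
    and degree: "\<And>j. (\<Sum>e | e \<in> U \<and> col e = j. b (lab e)) = d j * card W"
  obtains P where "\<And>e. e \<in> U \<Longrightarrow> P e \<subseteq> W \<and> card (P e) = b (lab e)"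
    and "\<And>x A. A \<subseteq> W \<Longrightarrow> card A = b x \<Longrightarrow> card {e\<in>U. lab e = x \<and> P e = A} = L x"
    and "\<And>j v. v \<in> W \<Longrightarrow> card {e\<in>U. col e = j \<and> v \<in> P e} = d j"
proof -
  \<comment> \<open>\<open>P e\<close> collects the vertices of \<open>e\<close> among the set \<open>Q\<close> of vertices already split off. An edge
    with label \<open>x\<close> and \<open>P e = A\<close> still has \<open>b x - card A\<close> vertices to receive from \<open>W - Q\<close>.\<close>
  let ?count = "\<lambda>Q P. \<forall>x. \<forall>A\<subseteq>Q. card {e\<in>U. lab e = x \<and> P e = A} =
    (if card A \<le> b x then L x * ((card W - card Q) choose (b x - card A)) else 0)"
  let ?deg = "\<lambda>Q P. \<forall>j. \<forall>v\<in>Q. card {e\<in>U. col e = j \<and> v \<in> P e} = d j"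
  have partial: "\<exists>P. (\<forall>e\<in>U. P e \<subseteq> Q) \<and> ?count Q P \<and> ?deg Q P" if "Q \<subseteq> W" for Q
    using finite_subset[OF that finW] that
  proof (induction Q rule: finite_induct)
    case empty
    show ?case by (rule exI[of _ "\<lambda>_. {}"]) (use count in auto)
  next
    case (insert v Q)
    then obtain P where PQ: "\<And>e. e \<in> U \<Longrightarrow> P e \<subseteq> Q" and cnt: "?count Q P" and deg: "?deg Q P"
      by auto
    have "card (insert v Q) \<le> card W" using insert.prems finW by (rule card_mono[rotated])
    then have "card Q < card W" using insert.hyps by simp
    then obtain N where N: "card W - card Q = Suc N"
      by (metis less_imp_Suc_add diff_add_inverse add_Suc_right)
    then have N': "card W - card (insert v Q) = N"
      using card_insert_disjoint[OF insert.hyps] by linarith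
    have cardP: "card (P e) \<le> b (lab e)" if "e \<in> U" for e
    proof (rule ccontr)
      assume "\<not> ?thesis"
      then have "card {e'\<in>U. lab e' = lab e \<and> P e' = P e} = 0"
        using cnt PQ[OF that] by auto
      then show False using that finU by auto
    qed
    \<comment> \<open>The classes of the next step are the pairs \<open>(lab e, P e)\<close>.\<close>
    define M where "M = (\<lambda>(x, A). if A \<subseteq> Q \<and> card A \<le> b x then L x else 0)"
    define \<beta> where "\<beta> = (\<lambda>(x, A :: 'v set). b x - card A)"
    have step_count: "card {e\<in>U. (lab e, P e) = k} = M k * (Suc N choose \<beta> k)" for k
    proof (cases k)
      case (Pair x A)
      show ?thesis
      proof (cases "A \<subseteq> Q")
        case True
        then show ?thesis using cnt N by (simp add: Pair M_def \<beta>_def)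
      next
        case False
        then have "{e\<in>U. lab e = x \<and> P e = A} = {}" using PQ by auto
        then have "card {e\<in>U. lab e = x \<and> P e = A} = 0" by (simp only: card.empty)
        then show ?thesis using False by (simp add: Pair M_def)
      qed
    qed
    have step_degree: "(\<Sum>e | e \<in> U \<and> col e = j. \<beta> (lab e, P e)) = d j * Suc N" for j
    proof -
      let ?Uj = "{e. e \<in> U \<and> col e = j}"
      have "(\<Sum>e\<in>?Uj. card (P e)) = (\<Sum>e\<in>?Uj. \<Sum>u\<in>Q. if u \<in> P e then 1 else 0)"
      proof (rule sum.cong[OF refl])
        fix e assume e: "e \<in> ?Uj"
        then have "Q \<inter> {u. u \<in> P e} = P e" using PQ by auto
        then show "card (P e) = (\<Sum>u\<in>Q. if u \<in> P e then 1 else 0)"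
          using insert.hyps(1) by (simp add: sum.If_cases)
      qed
      also have "\<dots> = (\<Sum>u\<in>Q. \<Sum>e\<in>?Uj. if u \<in> P e then 1 else 0)" by (rule sum.swap)
      also have "\<dots> = (\<Sum>u\<in>Q. d j)"
      proof (rule sum.cong[OF refl])
        fix u assume u: "u \<in> Q"
        have "?Uj \<inter> {e. u \<in> P e} = {e\<in>U. col e = j \<and> u \<in> P e}" by auto
        then show "(\<Sum>e\<in>?Uj. if u \<in> P e then 1 else 0) = d j"
          using deg u finU by (simp add: sum.If_cases)
      qed
      finally have sP: "(\<Sum>e\<in>?Uj. card (P e)) = d j * card Q" by simp
      have "(\<Sum>e\<in>?Uj. b (lab e)) = (\<Sum>e\<in>?Uj. \<beta> (lab e, P e) + card (P e))"
        using cardP by (intro sum.cong) (auto simp: \<beta>_def)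
      then have "(\<Sum>e\<in>?Uj. \<beta> (lab e, P e)) + d j * card Q = d j * card W"
        using sP degree[of j] by (simp add: sum.distrib)
      moreover have "card W = Suc N + card Q" using N by linarith
      ultimately show ?thesis by (simp add: algebra_simps)
    qed
    obtain Z where Z: "Z \<subseteq> U"
      "\<And>k. card {e\<in>Z. (lab e, P e) = k} = (if \<beta> k = 0 then 0 else M k * (N choose (\<beta> k - 1)))"
      "\<And>k. card {e\<in>U - Z. (lab e, P e) = k} = M k * (N choose \<beta> k)"
      "\<And>j. card {e\<in>Z. col e = j} = d j"
      using detach_one_vertex[of U "\<lambda>e. (lab e, P e)" M N \<beta> col d, OF finU step_count step_degree]
      by blast
    define P' where "P' = (\<lambda>e. if e \<in> Z then insert v (P e) else P e)"
    have vP: "v \<notin> P e" if "e \<in> U" for e using PQ[OF that] insert.hyps(2) by auto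
    have "\<forall>e\<in>U. P' e \<subseteq> insert v Q" using PQ by (auto simp: P'_def)
    moreover have "?count (insert v Q) P'"
    proof (intro allI impI)
      fix x A assume A: "A \<subseteq> insert v Q"
      then have finA: "finite A" using insert.hyps(1) finite_subset by auto
      show "card {e\<in>U. lab e = x \<and> P' e = A} = (if card A \<le> b x then
          L x * ((card W - card (insert v Q)) choose (b x - card A)) else 0)"
      proof (cases "v \<in> A")
        case True
        then have "{e\<in>U. lab e = x \<and> P' e = A} = {e\<in>Z. (lab e, P e) = (x, A - {v})}"
          using vP Z(1) by (auto simp: P'_def)
        then have "card {e\<in>U. lab e = x \<and> P' e = A} = (if \<beta> (x, A - {v}) = 0 then 0
            else M (x, A - {v}) * (N choose (\<beta> (x, A - {v}) - 1)))"
          using Z(2)[of "(x, A - {v})"] by (simp only:)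
        moreover have "card (A - {v}) = card A - 1" "0 < card A"
          using True finA by (auto simp: card_gt_0_iff)
        moreover have "A - {v} \<subseteq> Q" using A by auto
        ultimately show ?thesis unfolding N' by (auto simp: M_def \<beta>_def)
      next
        case False
        then have "{e\<in>U. lab e = x \<and> P' e = A} = {e\<in>U - Z. (lab e, P e) = (x, A)}"
          by (auto simp: P'_def)
        then have "card {e\<in>U. lab e = x \<and> P' e = A} = M (x, A) * (N choose \<beta> (x, A))"
          using Z(3)[of "(x, A)"] by (simp only:)
        moreover have "A \<subseteq> Q" using A False by auto
        ultimately show ?thesis unfolding N' by (auto simp: M_def \<beta>_def)
      qed
    qed
    moreover have "?deg (insert v Q) P'"
    proof (intro allI ballI)
      fix j u assume u: "u \<in> insert v Q"
      show "card {e\<in>U. col e = j \<and> u \<in> P' e} = d j"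
      proof (cases "u = v")
        case True
        then have "{e\<in>U. col e = j \<and> u \<in> P' e} = {e\<in>Z. col e = j}"
          using vP Z(1) by (auto simp: P'_def)
        then show ?thesis using Z(4) by simp
      next
        case False
        then have "{e\<in>U. col e = j \<and> u \<in> P' e} = {e\<in>U. col e = j \<and> u \<in> P e}"
          by (auto simp: P'_def)
        then show ?thesis using deg u False by simp
      qed
    qed
    ultimately show ?case by blast
  qed
  from partial[OF subset_refl] obtain P
    where P: "\<forall>e\<in>U. P e \<subseteq> W" "?count W P" "?deg W P" by (elim exE conjE)
  show thesis
  proof
    show "P e \<subseteq> W \<and> card (P e) = b (lab e)" if e: "e \<in> U" for e
    proof -
      have "card {e'\<in>U. lab e' = lab e \<and> P e' = P e} \<noteq> 0" using e finU by auto
      moreover have "card {e'\<in>U. lab e' = lab e \<and> P e' = P e} = (if card (P e) \<le> b (lab e)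
          then L (lab e) * (0 choose (b (lab e) - card (P e))) else 0)"
        using P(1,2) e by simp
      ultimately have "card (P e) \<le> b (lab e)" "(0::nat) choose (b (lab e) - card (P e)) \<noteq> 0"
        by (auto split: if_splits)
      then show ?thesis using P(1) e by (auto simp: binomial_eq_0_iff)
    qed
    show "card {e\<in>U. lab e = x \<and> P e = A} = L x" if "A \<subseteq> W" "card A = b x" for x A
      using P(2) that by simp
    show "card {e\<in>U. col e = j \<and> v \<in> P e} = d j" if "v \<in> W" for j v
      using P(3) that by blast
  qed
qed

section \<open>Splitting the edges of each color by type\<close>

lemma int_selection_with_sum:
  fixes lo hi :: "'j \<Rightarrow> int"
  assumes "finite J" and "\<And>j. j \<in> J \<Longrightarrow> lo j \<le> hi j"
    and "sum lo J \<le> t" and "t \<le> sum hi J"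
  obtains x where "\<And>j. j \<in> J \<Longrightarrow> lo j \<le> x j \<and> x j \<le> hi j" and "sum x J = t"
proof -
  have "\<exists>x. (\<forall>j\<in>J. lo j \<le> x j \<and> x j \<le> hi j) \<and> sum x J = t"
    using assms
  proof (induction J arbitrary: t rule: finite_induct)
    case empty
    then show ?case by auto
  next
    case (insert i J)
    define z where "z = max (lo i) (t - sum hi J)"
    have "sum lo J \<le> sum hi J" using insert.prems(1) by (intro sum_mono) auto
    then have "sum lo J \<le> t - z" "t - z \<le> sum hi J" "lo i \<le> z" "z \<le> hi i"
      using insert.prems insert.hyps by (auto simp: z_def max_def)
    then obtain x where x: "\<forall>j\<in>J. lo j \<le> x j \<and> x j \<le> hi j" "sum x J = t - z"
      using insert.IH[of "t - z"] insert.prems(1) by auto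
    have "sum (x(i := z)) J = sum x J" using insert.hyps(2) by (intro sum.cong) auto
    then have "sum (x(i := z)) (insert i J) = t"
      using insert.hyps x(2) by simp
    moreover have "\<forall>j\<in>insert i J. lo j \<le> (x(i := z)) j \<and> (x(i := z)) j \<le> hi j"
      using x(1) \<open>lo i \<le> z\<close> \<open>z \<le> hi i\<close> by auto
    ultimately show ?case by blast
  qed
  then show thesis using that by blast
qed

text \<open>
  \<open>e j a\<close> is to be the number of edges of color \<open>j\<close> that have \<open>a\<close> vertices in \<open>[m]\<close>, so that
  \<open>E j\<close> edges of that color have total degree \<open>D j\<close> in \<open>[m]\<close>.
\<close>

definition edge_split ::
  "'j set \<Rightarrow> ('j \<Rightarrow> int) \<Rightarrow> ('j \<Rightarrow> int) \<Rightarrow> (nat \<Rightarrow> int) \<Rightarrow> bool" where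
  "edge_split J D E T \<longleftrightarrow> (\<exists>e :: 'j \<Rightarrow> nat \<Rightarrow> nat.
     (\<forall>j\<in>J. (\<Sum>a\<le>3. int (e j a)) = E j \<and> (\<Sum>a\<le>3. int a * int (e j a)) = D j) \<and>
     (\<forall>a\<le>3. (\<Sum>j\<in>J. int (e j a)) = T a))"

lemma sum_upto_3: "(\<Sum>a\<le>(3::nat). f a) = f 0 + f 1 + f 2 + (f 3 :: 'a :: comm_monoid_add)"
  by (simp add: eval_nat_numeral)

text \<open>
  The equations are invariant under exchanging \<open>a\<close> and \<open>3 - a\<close>, with \<open>3 * E - D\<close> in place of
  \<open>D\<close>.
\<close>

lemma edge_split_reverse:
  assumes "edge_split J (\<lambda>j. 3 * E j - D j) E (\<lambda>a. T (3 - a))"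
  shows "edge_split J D E T"
proof -
  obtain e :: "'a \<Rightarrow> nat \<Rightarrow> nat" where
    e: "\<And>j. j \<in> J \<Longrightarrow> (\<Sum>a\<le>3. int (e j a)) = E j \<and> (\<Sum>a\<le>3. int a * int (e j a)) = 3 * E j - D j"
    and T: "\<And>a. a \<le> 3 \<Longrightarrow> (\<Sum>j\<in>J. int (e j a)) = T (3 - a)"
    using assms unfolding edge_split_def by blast
  have "(\<Sum>j\<in>J. int (e j (3 - a))) = T a" if "a \<le> 3" for a
    using T[of "3 - a"] that by simp
  moreover have "(\<Sum>a\<le>3. int (e j (3 - a))) = E j \<and> (\<Sum>a\<le>3. int a * int (e j (3 - a))) = D j"
    if "j \<in> J" for j
    using e[OF that] unfolding sum_upto_3 by simp
  ultimately show ?thesis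
    unfolding edge_split_def by (intro exI[of _ "\<lambda>j a. e j (3 - a)"]) blast
qed

text \<open>
  With \<open>x j\<close> edges of type 3 and \<open>y j\<close> of type 2 in color \<open>j\<close>, the numbers of types 1 and 0 are
  \<open>D j - 3 * x j - 2 * y j\<close> and \<open>E j - D j + 2 * x j + y j\<close>. They are nonnegative iff \<open>y j\<close>
  lies between \<open>D j - E j - 2 * x j\<close> and \<open>(D j - 3 * x j) / 2\<close>; hence \<open>x j \<ge> D j - 2 * E j\<close> and
  \<open>x j \<le> D j / 3\<close> are needed. Once \<open>x\<close> is fixed, a \<open>y\<close> with the right sum exists iff \<open>T 2\<close> lies
  between the sums of the bounds. The lower bound, cut off at 0, is convex in \<open>x j\<close>, and no
  more than rounding is lost if all \<open>x j\<close> lie on the same side of the kink \<open>c j / 2\<close>. The upper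
  bound loses 1/2 for each odd \<open>D j - 3 * x j\<close>. The last two hypotheses control these two kinds
  of losses.
\<close>

lemma edge_split_exists:
  fixes D E :: "'j \<Rightarrow> int" and T :: "nat \<Rightarrow> int"
  defines "c \<equiv> (\<lambda>j. max 0 (D j - E j))"
  assumes fin: "finite J"
    and D0: "\<And>j. j \<in> J \<Longrightarrow> 0 \<le> D j" and DE: "\<And>j. j \<in> J \<Longrightarrow> D j \<le> 3 * E j"
    and sumE: "(\<Sum>j\<in>J. E j) = T 0 + T 1 + T 2 + T 3"
    and sumD: "(\<Sum>j\<in>J. D j) = T 1 + 2 * T 2 + 3 * T 3"
    and low: "(\<Sum>j\<in>J. max 0 (D j - 2 * E j)) \<le> T 3"
    and mid: "(\<Sum>j\<in>J. c j) \<le> 2 * T 3 + T 2"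
    and high: "T 3 \<le> (\<Sum>j\<in>J. D j div 3)"
    and parity: "int (card J) \<le> T 1 \<or> (\<forall>j\<in>J. even (D j)) \<and> T 3 \<le> T 1"
    and odd_c: "(\<Sum>j\<in>J. c j div 2) < T 3 \<Longrightarrow> int (card {j\<in>J. odd (c j)}) \<le> T 2"
  shows "edge_split J D E T"
proof -
  define h where "h = (\<lambda>j. c j div 2)"
  have lh: "max 0 (D j - 2 * E j) \<le> h j" "h j \<le> D j div 3" if "j \<in> J" for j
    using D0[OF that] DE[OF that] by (auto simp: h_def c_def max_def)
  have card_sum: "int (card {j\<in>J. R j}) = (\<Sum>j\<in>J. if R j then 1 else 0)" for R
    using fin by (simp add: sum.If_cases Int_def)
  have "\<exists>x. (\<forall>j\<in>J. max 0 (D j - 2 * E j) \<le> x j \<and> x j \<le> D j div 3) \<and> sum x J = T 3 \<and>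
    (\<Sum>j\<in>J. max 0 (D j - E j - 2 * x j)) \<le> T 2"
  proof (cases "T 3 \<le> sum h J")
    case True
    then obtain x where x: "\<And>j. j \<in> J \<Longrightarrow> max 0 (D j - 2 * E j) \<le> x j \<and> x j \<le> h j" "sum x J = T 3"
      using int_selection_with_sum[OF fin lh(1) low True] by blast
    have "(\<Sum>j\<in>J. max 0 (D j - E j - 2 * x j)) \<le> (\<Sum>j\<in>J. c j - 2 * x j)"
    proof (rule sum_mono)
      fix j assume "j \<in> J"
      then have "2 * x j \<le> c j" using x(1)[of j] by (auto simp: h_def)
      then show "max 0 (D j - E j - 2 * x j) \<le> c j - 2 * x j" by (auto simp: c_def)
    qed
    also have "\<dots> = sum c J - 2 * T 3" by (simp add: sum_subtractf x(2) flip: sum_distrib_left)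
    also have "\<dots> \<le> T 2" using mid by simp
    finally show ?thesis using x lh(2) by (meson order_trans)
  next
    case False
    then have "sum h J \<le> T 3" by simp
    then obtain x where x: "\<And>j. j \<in> J \<Longrightarrow> h j \<le> x j \<and> x j \<le> D j div 3" "sum x J = T 3"
      using int_selection_with_sum[OF fin lh(2) _ high] by blast
    have "(\<Sum>j\<in>J. max 0 (D j - E j - 2 * x j)) \<le> (\<Sum>j\<in>J. if odd (c j) then 1 else 0)"
    proof (rule sum_mono)
      fix j assume "j \<in> J"
      then have "c j div 2 \<le> x j" using x(1)[of j] unfolding h_def by blast
      then have "c j - 2 * x j \<le> c j mod 2" by presburger
      moreover have "c j mod 2 = (if odd (c j) then 1 else 0)" by presburger
      ultimately show "max 0 (D j - E j - 2 * x j) \<le> (if odd (c j) then 1 else 0)"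
        by (auto simp: c_def)
    qed
    also have "\<dots> = int (card {j\<in>J. odd (c j)})" by (rule card_sum[symmetric])
    also have "\<dots> \<le> T 2" using odd_c False by (simp add: h_def)
    finally show ?thesis using x lh(1) by (meson order_trans)
  qed
  then obtain x where x: "\<And>j. j \<in> J \<Longrightarrow> max 0 (D j - 2 * E j) \<le> x j \<and> x j \<le> D j div 3"
    and sumx: "sum x J = T 3" and low2: "(\<Sum>j\<in>J. max 0 (D j - E j - 2 * x j)) \<le> T 2" by blast
  \<comment> \<open>If all \<open>D j\<close> are even, the odd terms are those with odd \<open>x j\<close>, and \<open>x j \<ge> 1\<close> for them.\<close>
  have "int (card {j\<in>J. odd (D j - 3 * x j)}) \<le> T 1"
    using parity
  proof
    assume "int (card J) \<le> T 1"
    moreover have "card {j\<in>J. odd (D j - 3 * x j)} \<le> card J" using fin by (intro card_mono) auto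
    ultimately show ?thesis by linarith
  next
    assume *: "(\<forall>j\<in>J. even (D j)) \<and> T 3 \<le> T 1"
    have "(\<Sum>j\<in>J. if odd (D j - 3 * x j) then 1 else 0) \<le> sum x J"
    proof (rule sum_mono)
      fix j assume j: "j \<in> J"
      have "odd (x j) \<Longrightarrow> x j \<noteq> 0" by auto
      then show "(if odd (D j - 3 * x j) then 1 else 0) \<le> x j" using * x[OF j] j by auto
    qed
    then show ?thesis unfolding card_sum using * sumx by linarith
  qed
  moreover have "(\<Sum>j\<in>J. D j - 3 * x j) \<le>
      (\<Sum>j\<in>J. 2 * ((D j - 3 * x j) div 2) + (if odd (D j - 3 * x j) then 1 else 0))"
  proof (rule sum_mono)
    fix j
    show "D j - 3 * x j \<le> 2 * ((D j - 3 * x j) div 2) + (if odd (D j - 3 * x j) then 1 else 0)"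
      by presburger
  qed
  ultimately have "(\<Sum>j\<in>J. D j) - 3 * T 3 \<le> 2 * (\<Sum>j\<in>J. (D j - 3 * x j) div 2) + T 1"
    by (simp add: sum.distrib sum_subtractf card_sum sumx flip: sum_distrib_left)
  then have high2: "T 2 \<le> (\<Sum>j\<in>J. (D j - 3 * x j) div 2)" using sumD by linarith
  have yrange: "max 0 (D j - E j - 2 * x j) \<le> (D j - 3 * x j) div 2" if "j \<in> J" for j
    using x[OF that] by (auto simp: max_def split: if_splits)
  then obtain y where y: "\<And>j. j \<in> J \<Longrightarrow>
      max 0 (D j - E j - 2 * x j) \<le> y j \<and> y j \<le> (D j - 3 * x j) div 2" and sumy: "sum y J = T 2"
    using int_selection_with_sum[OF fin yrange low2 high2] by blast
  define e where "e = (\<lambda>j a. nat ([E j - D j + 2 * x j + y j, D j - 3 * x j - 2 * y j, y j, x j] ! a))"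
  have e: "int (e j 0) = E j - D j + 2 * x j + y j" "int (e j 1) = D j - 3 * x j - 2 * y j"
    "int (e j 2) = y j" "int (e j 3) = x j" if "j \<in> J" for j
    using x[OF that] y[OF that] by (auto simp: e_def max_def eval_nat_numeral split: if_splits)
  have "(\<Sum>j\<in>J. int (e j a)) = T a" if a: "a \<le> 3" for a
  proof -
    consider "a = 0" | "a = 1" | "a = 2" | "a = 3" using a by linarith
    then show ?thesis
    proof cases
      case 1
      have "(\<Sum>j\<in>J. int (e j 0)) = (\<Sum>j\<in>J. E j - D j + 2 * x j + y j)" using e(1) by simp
      then show ?thesis using 1 sumE sumD sumx sumy
        by (simp add: sum.distrib sum_subtractf flip: sum_distrib_left)
    next
      case 2
      have "(\<Sum>j\<in>J. int (e j 1)) = (\<Sum>j\<in>J. D j - 3 * x j - 2 * y j)"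
        using e(2) by (rule sum.cong[OF refl])
      then show ?thesis using 2 sumD sumx sumy
        by (simp add: sum.distrib sum_subtractf flip: sum_distrib_left)
    qed (use e sumx sumy in auto)
  qed
  moreover have "(\<Sum>a\<le>3. int (e j a)) = E j \<and> (\<Sum>a\<le>3. int a * int (e j a)) = D j" if "j \<in> J" for j
    unfolding sum_upto_3 e[OF that] by auto
  ultimately show ?thesis unfolding edge_split_def by blast
qed

section \<open>From an edge split to an extension\<close>

text \<open>
  The old colors \<open>j \<le> q\<close> already have degree \<open>r\<close> at the vertices of \<open>[m]\<close>.
\<close>

definition missing_degree :: "nat \<Rightarrow> nat \<Rightarrow> nat \<Rightarrow> nat \<Rightarrow> nat" where
  "missing_degree r s q j = (if j \<le> q then s - r else s)"

text \<open>
  The number of edges of \<open>\<lambda>K\<^sub>n\<^sup>4\<close> with exactly \<open>a\<close> vertices in \<open>[m]\<close>.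
\<close>

definition edge_types :: "nat \<Rightarrow> nat \<Rightarrow> nat \<Rightarrow> nat \<Rightarrow> int" where
  "edge_types lam m n a = int (lam * (m choose a) * ((n - m) choose (4 - a)))"

lemma finite_complete_edges [simp]: "finite (complete_edges lam m h)"
proof -
  have "finite {A. A \<subseteq> {1..m} \<and> card A = h}" by (rule finite_subset[of _ "Pow {1..m}"]) auto
  then show ?thesis by (simp add: complete_edges_def)
qed

text \<open>
  This decides which of the \<open>lam\<close> copies of its vertex set \<open>F e\<close> an abstract edge \<open>e\<close> becomes.
\<close>

lemma copies_of_fibres:
  assumes "finite U" and "F ` U \<subseteq> Ys" and "\<And>Y. Y \<in> Ys \<Longrightarrow> card {e\<in>U. F e = Y} = lam"
  obtains \<beta> where "bij_betw \<beta> (Ys \<times> {1..lam}) U" and "\<And>p. p \<in> Ys \<times> {1..lam} \<Longrightarrow> F (\<beta> p) = fst p"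
proof -
  have "\<forall>Y\<in>Ys. \<exists>h. bij_betw h {1..lam} {e\<in>U. F e = Y}"
    using assms(1,3) by (intro ballI finite_same_card_bij) auto
  from bchoice[OF this] obtain h
    where h: "\<And>Y. Y \<in> Ys \<Longrightarrow> bij_betw (h Y) {1..lam} {e\<in>U. F e = Y}" by blast
  have hU: "h Y i \<in> U" "F (h Y i) = Y" if "Y \<in> Ys" "i \<in> {1..lam}" for Y i
    using bij_betwE[OF h[OF that(1)]] that(2) by auto
  have "bij_betw (\<lambda>p. h (fst p) (snd p)) (Ys \<times> {1..lam}) U"
    unfolding bij_betw_def
  proof
    show "inj_on (\<lambda>p. h (fst p) (snd p)) (Ys \<times> {1..lam})"
    proof (rule inj_onI)
      fix p p' assume p: "p \<in> Ys \<times> {1..lam}" "p' \<in> Ys \<times> {1..lam}"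
        "h (fst p) (snd p) = h (fst p') (snd p')"
      have "F (h (fst p) (snd p)) = fst p" "F (h (fst p') (snd p')) = fst p'"
        using p(1,2) by (auto intro!: hU(2))
      then have "fst p = fst p'" using p(3) by simp
      moreover have "snd p = snd p'"
      proof (rule inj_onD[OF bij_betw_imp_inj_on[OF h, of "fst p"]])
        show "h (fst p) (snd p) = h (fst p) (snd p')" using p(3) calculation by simp
      qed (use p(1,2) in auto)
      ultimately show "p = p'" by (rule prod_eqI)
    qed
    show "(\<lambda>p. h (fst p) (snd p)) ` (Ys \<times> {1..lam}) = U"
    proof
      show "U \<subseteq> (\<lambda>p. h (fst p) (snd p)) ` (Ys \<times> {1..lam})"
      proof
        fix e assume e: "e \<in> U"
        then have "F e \<in> Ys" using assms(2) by auto
        then have "e \<in> h (F e) ` {1..lam}" using e bij_betw_imp_surj_on[OF h] by blast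
        then show "e \<in> (\<lambda>p. h (fst p) (snd p)) ` (Ys \<times> {1..lam})"
          using \<open>F e \<in> Ys\<close> by force
      qed
    qed (use hU in auto)
  qed
  then show thesis by (rule that) (use hU(2) in \<open>auto simp: mem_Times_iff\<close>)
qed

text \<open>
  The set \<open>U\<close> consists of \<open>e j a\<close> abstract edges for every color \<open>j\<close> and type \<open>a\<close>. A first
  detachment, with the types as labels, gives each edge its vertices \<open>P1\<close> in \<open>[m]\<close>; a second one,
  with these sets as labels, gives it its vertices \<open>P2\<close> outside \<open>[m]\<close>. The latter does not disturb the
  degrees in \<open>[m]\<close>, and it uses every 4-set not contained in \<open>[m]\<close> exactly \<open>lam\<close> times.
\<close>

lemma extension_if_edge_split:
  assumes mn: "m < n" and fac: "factorization r lam m 4 q f" and "r \<le> s" and qq: "q \<le> q'"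
    and split: "edge_split {1..q'} (\<lambda>j. int (missing_degree r s q j * m)) E (edge_types lam m n)"
    and E: "\<And>j. j \<in> {1..q'} \<Longrightarrow> 4 * E j = int (missing_degree r s q j * m + s * (n - m))"
  shows "extends_to_factorization s lam n m 4 q f"
proof -
  obtain e :: "nat \<Rightarrow> nat \<Rightarrow> nat"
    where eE: "\<And>j. j \<in> {1..q'} \<Longrightarrow> (\<Sum>a\<le>3. int (e j a)) = E j"
    and eD: "\<And>j. j \<in> {1..q'} \<Longrightarrow> (\<Sum>a\<le>3. int a * int (e j a)) = int (missing_degree r s q j * m)"
    and eT: "\<And>a. a \<le> 3 \<Longrightarrow> (\<Sum>j\<in>{1..q'}. int (e j a)) = edge_types lam m n a"
    using split unfolding edge_split_def by blast
  define U where "U = (SIGMA j:{1..q'}. SIGMA a:{..3}. {..<e j a})"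
  define col where "col = (fst :: nat \<times> nat \<times> nat \<Rightarrow> nat)"
  define lab where "lab = (\<lambda>u :: nat \<times> nat \<times> nat. fst (snd u))"
  have finU: "finite U" by (simp add: U_def)
  have colU: "{u\<in>U. col u = j} = (if j \<in> {1..q'} then Pair j ` (SIGMA a:{..3}. {..<e j a}) else {})" for j
    by (auto simp: U_def col_def)
  have sum_col: "(\<Sum>u | u \<in> U \<and> col u = j. g (lab u)) = (\<Sum>a\<le>3. e j a * g a)"
    if "j \<in> {1..q'}" for j and g :: "nat \<Rightarrow> nat"
  proof -
    have "(\<Sum>u | u \<in> U \<and> col u = j. g (lab u)) = (\<Sum>p\<in>(SIGMA a:{..3}. {..<e j a}). g (fst p))"
      using that colU[of j] by (simp add: sum.reindex inj_on_def lab_def)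
    also have "\<dots> = (\<Sum>a\<le>3. \<Sum>i<e j a. g a)" by (subst sum.Sigma) (auto intro!: sum.cong)
    finally show ?thesis by simp
  qed
  have lab3: "lab u \<le> 3" if "u \<in> U" for u using that by (auto simp: U_def lab_def)
  \<comment> \<open>The detachment theorem quantifies over all labels and colors, so its multiplicities and
    degrees are set to 0 where there are no edges.\<close>
  define L1 where "L1 = (\<lambda>a. if a \<le> 3 then lam * ((n - m) choose (4 - a)) else 0)"
  define d1 where "d1 = (\<lambda>j. if j \<in> {1..q'} then missing_degree r s q j else 0)"
  define d2 where "d2 = (\<lambda>j. if j \<in> {1..q'} then s else 0)"
  have count1: "card {u\<in>U. lab u = a} = L1 a * (card {1..m} choose a)" for a
  proof (cases "a \<le> 3")
    case True
    have "{u\<in>U. lab u = a} = (\<lambda>(j, i). (j, a, i)) ` (SIGMA j:{1..q'}. {..<e j a})"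
      using True by (force simp: U_def lab_def)
    moreover have "inj_on (\<lambda>(j, i). (j, a, i)) (SIGMA j:{1..q'}. {..<e j a})"
      by (auto simp: inj_on_def)
    ultimately have "card {u\<in>U. lab u = a} = (\<Sum>j\<in>{1..q'}. e j a)"
      by (simp add: card_image)
    then have "int (card {u\<in>U. lab u = a}) = edge_types lam m n a" using eT[OF True] by simp
    then have "card {u\<in>U. lab u = a} = lam * (m choose a) * ((n - m) choose (4 - a))"
      unfolding edge_types_def by (simp only: of_nat_eq_iff)
    then show ?thesis using True by (simp add: L1_def)
  next
    case False
    then have "{u\<in>U. lab u = a} = {}" using lab3 by auto
    then have "card {u\<in>U. lab u = a} = 0" by (simp only: card.empty)
    then show ?thesis using False by (simp add: L1_def)
  qed
  have degree1: "(\<Sum>u | u \<in> U \<and> col u = j. lab u) = d1 j * card {1..m}" for j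
  proof (cases "j \<in> {1..q'}")
    case True
    have "(\<Sum>a\<le>3. int a * int (e j a)) = int (\<Sum>a\<le>3. e j a * a)" by (simp add: mult.commute)
    then have "(\<Sum>a\<le>3. e j a * a) = missing_degree r s q j * m"
      using eD[OF True] by (simp only: of_nat_eq_iff)
    then show ?thesis using sum_col[OF True, of "\<lambda>a. a"] True by (simp add: d1_def)
  next
    case False
    then have "{u. u \<in> U \<and> col u = j} = {}" using colU[of j] False by (simp only: if_False)
    then have "(\<Sum>u | u \<in> U \<and> col u = j. lab u) = 0" by (simp only: sum.empty)
    then show ?thesis using False by (auto simp: d1_def)
  qed
  obtain P1 where P1: "\<And>u. u \<in> U \<Longrightarrow> P1 u \<subseteq> {1..m} \<and> card (P1 u) = lab u"
    and P1_count: "\<And>a A. A \<subseteq> {1..m} \<Longrightarrow> card A = a \<Longrightarrow> card {u\<in>U. lab u = a \<and> P1 u = A} = L1 a"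
    and P1_degree: "\<And>j v. v \<in> {1..m} \<Longrightarrow> card {u\<in>U. col u = j \<and> v \<in> P1 u} = d1 j"
  proof (rule detachment[of U "{1..m}" lab L1 "\<lambda>a. a" col d1,
          OF finU finite_atLeastAtMost count1 degree1])
  qed (rule that)

  define L2 where "L2 = (\<lambda>A. if A \<subseteq> {1..m} \<and> card A \<le> 3 then lam else 0)"
  have cardW: "card {m+1..n} = n - m" by simp
  have count2: "card {u\<in>U. P1 u = A} = L2 A * (card {m+1..n} choose (4 - card A))" for A
  proof (cases "A \<subseteq> {1..m} \<and> card A \<le> 3")
    case True
    have "{u\<in>U. P1 u = A} = {u\<in>U. lab u = card A \<and> P1 u = A}" using P1 by auto
    then show ?thesis using P1_count[of A "card A"] True unfolding cardW by (simp add: L1_def L2_def)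
  next
    case False
    then have "{u\<in>U. P1 u = A} = {}" using P1 lab3 by fastforce
    then have "card {u\<in>U. P1 u = A} = 0" by (simp only: card.empty)
    moreover have "L2 A = 0" using False unfolding L2_def by (simp only: if_False)
    ultimately show ?thesis by simp
  qed
  have degree2: "(\<Sum>u | u \<in> U \<and> col u = j. 4 - card (P1 u)) = d2 j * card {m+1..n}" for j
  proof (cases "j \<in> {1..q'}")
    case True
    have "int (\<Sum>a\<le>3. e j a * (4 - a)) = 4 * E j - int (missing_degree r s q j * m)"
      unfolding eE[OF True, symmetric] eD[OF True, symmetric] by (simp add: sum_upto_3)
    then have "int (\<Sum>a\<le>3. e j a * (4 - a)) = int (s * (n - m))" unfolding E[OF True] by simp
    then have "(\<Sum>a\<le>3. e j a * (4 - a)) = s * (n - m)" by (simp only: of_nat_eq_iff)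
    moreover have "(\<Sum>u | u \<in> U \<and> col u = j. 4 - card (P1 u)) = (\<Sum>u | u \<in> U \<and> col u = j. 4 - lab u)"
      using P1 by (intro sum.cong) auto
    ultimately show ?thesis using sum_col[OF True, of "\<lambda>a. 4 - a"] True unfolding cardW
      by (simp add: d2_def)
  next
    case False
    then have "{u. u \<in> U \<and> col u = j} = {}" using colU[of j] False by (simp only: if_False)
    then have "(\<Sum>u | u \<in> U \<and> col u = j. 4 - card (P1 u)) = 0" by (simp only: sum.empty)
    then show ?thesis using False by (auto simp: d2_def)
  qed
  obtain P2 where P2: "\<And>u. u \<in> U \<Longrightarrow> P2 u \<subseteq> {m+1..n} \<and> card (P2 u) = 4 - card (P1 u)"
    and P2_count: "\<And>A B. B \<subseteq> {m+1..n} \<Longrightarrow> card B = 4 - card A \<Longrightarrow>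
      card {u\<in>U. P1 u = A \<and> P2 u = B} = L2 A"
    and P2_degree: "\<And>j v. v \<in> {m+1..n} \<Longrightarrow> card {u\<in>U. col u = j \<and> v \<in> P2 u} = d2 j"
  proof (rule detachment[of U "{m+1..n}" P1 L2 "\<lambda>A. 4 - card A" col d2,
          OF finU finite_atLeastAtMost count2 degree2])
  qed (rule that)

  define F where "F = (\<lambda>u. P1 u \<union> P2 u)"
  define Ys where "Ys = {Y. Y \<subseteq> {1..n} \<and> card Y = 4 \<and> \<not> Y \<subseteq> {1..m}}"
  have dis: "{1..m} \<inter> {m+1..n} = {}" by auto
  have F: "F u \<inter> {1..m} = P1 u" "F u \<inter> {m+1..n} = P2 u" if "u \<in> U" for u
    using P1[OF that] P2[OF that] dis unfolding F_def by blast+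
  have FU: "F ` U \<subseteq> Ys"
  proof
    fix Y assume "Y \<in> F ` U"
    then obtain u where u: "u \<in> U" "Y = F u" by auto
    have fin: "finite (P1 u)" "finite (P2 u)"
      using P1[OF u(1)] P2[OF u(1)] finite_subset by blast+
    have lt: "card (P1 u) \<le> 3" using P1[OF u(1)] lab3[OF u(1)] by simp
    have "P1 u \<inter> P2 u = {}" using P1[OF u(1)] P2[OF u(1)] dis by blast
    then have c4: "card Y = 4" using fin lt P2[OF u(1)] u(2) by (simp add: F_def card_Un_disjoint)
    have "P2 u \<noteq> {}" using P2[OF u(1)] lt by force
    then obtain v where v: "v \<in> P2 u" by auto
    then have "v \<in> Y" "v \<notin> {1..m}" using P2[OF u(1)] u(2) by (auto simp: F_def)
    moreover have "Y \<subseteq> {1..n}" using P1[OF u(1)] P2[OF u(1)] mn u(2) unfolding F_def by force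
    ultimately show "Y \<in> Ys" using c4 by (auto simp: Ys_def)
  qed
  have F_count: "card {u\<in>U. F u = Y} = lam" if Y: "Y \<in> Ys" for Y
  proof -
    let ?A = "Y \<inter> {1..m}" and ?B = "Y \<inter> {m+1..n}"
    have Y': "Y \<subseteq> {1..n}" "card Y = 4" "\<not> Y \<subseteq> {1..m}" using Y by (auto simp: Ys_def)
    have finY: "finite Y" using Y'(1) finite_subset by blast
    have YAB: "Y = ?A \<union> ?B" using Y'(1) by auto
    have "?A \<inter> ?B = {}" by auto
    then have c: "card ?A + card ?B = 4"
      using Y'(2) finY YAB by (metis card_Un_disjoint finite_Int)
    have "?A \<subset> Y" using Y'(3) by auto
    then have "card ?A < 4" using psubset_card_mono[OF finY] Y'(2) by simp
    have "{u\<in>U. F u = Y} = {u\<in>U. P1 u = ?A \<and> P2 u = ?B}"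
    proof (rule Collect_cong, rule conj_cong[OF refl])
      fix u assume u: "u \<in> U"
      show "F u = Y \<longleftrightarrow> P1 u = ?A \<and> P2 u = ?B"
      proof
        assume "F u = Y"
        then show "P1 u = ?A \<and> P2 u = ?B" using F[OF u] by simp
      next
        assume "P1 u = ?A \<and> P2 u = ?B"
        then have "F u = ?A \<union> ?B" by (simp only: F_def)
        then show "F u = Y" by (rule trans[OF _ YAB[symmetric]])
      qed
    qed
    then show ?thesis using P2_count[of ?B ?A] c \<open>card ?A < 4\<close> by (simp add: L2_def)
  qed
  obtain \<beta> where \<beta>: "bij_betw \<beta> (Ys \<times> {1..lam}) U"
    and F\<beta>: "\<And>p. p \<in> Ys \<times> {1..lam} \<Longrightarrow> F (\<beta> p) = fst p"
    using copies_of_fibres[OF finU FU F_count] by blast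
  define g where "g = (\<lambda>p. if fst p \<subseteq> {1..m} then f p else col (\<beta> p))"
  have fcol: "f p \<in> {1..q}" if "p \<in> complete_edges lam m 4" for p
    using fac that unfolding factorization_def coloring_def by (blast dest: funcset_mem)
  have edges: "complete_edges lam n 4 = complete_edges lam m 4 \<union> Ys \<times> {1..lam}"
    using mn by (auto simp: complete_edges_def Ys_def)
  have newg: "g p = col (\<beta> p)" if "p \<in> Ys \<times> {1..lam}" for p using that by (auto simp: g_def Ys_def)
  have oldg: "g p = f p" if "p \<in> complete_edges lam m 4" for p
    using that by (auto simp: g_def complete_edges_def)
  have "coloring lam n 4 q' g"
    unfolding coloring_def edges
  proof
    fix p assume "p \<in> complete_edges lam m 4 \<union> Ys \<times> {1..lam}"
    then show "g p \<in> {1..q'}"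
    proof
      assume "p \<in> complete_edges lam m 4"
      then show ?thesis using oldg fcol qq by fastforce
    next
      assume p: "p \<in> Ys \<times> {1..lam}"
      then have "\<beta> p \<in> U" using \<beta> by (auto dest: bij_betwE)
      then show ?thesis using newg[OF p] by (auto simp: U_def col_def)
    qed
  qed
  moreover have "degree (color_class lam n 4 g j) v = s" if j: "j \<in> {1..q'}" and v: "v \<in> {1..n}" for j v
  proof -
    let ?old = "{p \<in> color_class lam m 4 f j. v \<in> fst p}"
    let ?new = "{p \<in> Ys \<times> {1..lam}. v \<in> fst p \<and> col (\<beta> p) = j}"
    have "{p \<in> color_class lam n 4 g j. v \<in> fst p} = ?old \<union> ?new"
      using newg oldg unfolding color_class_def edges by auto
    moreover have "?old \<inter> ?new = {}" by (auto simp: color_class_def complete_edges_def Ys_def)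
    moreover have "finite (?old \<union> ?new)"
      unfolding calculation(1)[symmetric] by (auto simp: color_class_def)
    ultimately have deg: "degree (color_class lam n 4 g j) v = degree (color_class lam m 4 f j) v + card ?new"
      unfolding degree_def by (simp add: card_Un_disjoint)
    have "?new = {p \<in> Ys \<times> {1..lam}. col (\<beta> p) = j \<and> v \<in> F (\<beta> p)}"
      using F\<beta> by (intro Collect_cong) auto
    then have "\<beta> ` ?new = {u \<in> \<beta> ` (Ys \<times> {1..lam}). col u = j \<and> v \<in> F u}"
      by (simp only:) blast
    then have "\<beta> ` ?new = {u\<in>U. col u = j \<and> v \<in> F u}"
      by (simp only: bij_betw_imp_surj_on[OF \<beta>])
    moreover have "inj_on \<beta> ?new"
      by (rule inj_on_subset[OF bij_betw_imp_inj_on[OF \<beta>]]) blast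
    ultimately have new: "card ?new = card {u\<in>U. col u = j \<and> v \<in> F u}"
      by (simp only: card_image[symmetric])
    show ?thesis
    proof (cases "v \<in> {1..m}")
      case True
      then have "{u\<in>U. col u = j \<and> v \<in> F u} = {u\<in>U. col u = j \<and> v \<in> P1 u}"
        using F(1) by blast
      then have "card ?new = missing_degree r s q j" using new P1_degree[OF True] j by (simp add: d1_def)
      moreover have "degree (color_class lam m 4 f j) v = (if j \<le> q then r else 0)"
      proof (cases "j \<le> q")
        case True
        then show ?thesis using fac \<open>v \<in> {1..m}\<close> j by (simp add: factorization_def)
      next
        case False
        then have "color_class lam m 4 f j = {}" using fcol by (force simp: color_class_def)
        then show ?thesis using False by (simp add: degree_def)
      qed
      ultimately show ?thesis using deg \<open>r \<le> s\<close> by (simp add: missing_degree_def)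
    next
      case False
      then have vW: "v \<in> {m+1..n}" using v by auto
      then have "{u\<in>U. col u = j \<and> v \<in> F u} = {u\<in>U. col u = j \<and> v \<in> P2 u}"
        using F(2) by blast
      then have "card ?new = s" using new P2_degree[OF vW] j by (simp add: d2_def)
      moreover have "?old = {}" using False by (auto simp: color_class_def complete_edges_def)
      then have "degree (color_class lam m 4 f j) v = 0" unfolding degree_def by (simp only: card.empty)
      ultimately show ?thesis using deg by simp
    qed
  qed
  ultimately have "factorization s lam n 4 q' g" by (simp add: factorization_def)
  moreover have "{1..q} \<subseteq> {1..q'}" using qq by simp
  moreover have "\<forall>p\<in>complete_edges lam m 4. g p = f p" using oldg by simp
  ultimately have "{1..q} \<subseteq> {1..q'} \<and> factorization s lam n 4 q' g \<and>
      (\<forall>p\<in>complete_edges lam m 4. g p = f p)"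
    by (simp only: conj_assoc simp_thms)
  then have "\<exists>g. {1..q} \<subseteq> {1..q'} \<and> factorization s lam n 4 q' g \<and>
      (\<forall>p\<in>complete_edges lam m 4. g p = f p)"
    by (rule exI[of _ g])
  then show ?thesis unfolding extends_to_factorization_def by (rule exI[of _ q'])
qed

section \<open>From an extension to an edge split\<close>

lemma sum_degree:
  assumes "finite V" and "finite Es"
  shows "(\<Sum>v\<in>V. degree Es v) = (\<Sum>p\<in>Es. card (fst p \<inter> V))"
proof -
  have "(\<Sum>v\<in>V. degree Es v) = (\<Sum>v\<in>V. \<Sum>p\<in>Es. if v \<in> fst p then 1 else 0)"
    using assms(2) by (intro sum.cong) (auto simp: degree_def sum.If_cases Int_def)
  also have "\<dots> = (\<Sum>p\<in>Es. \<Sum>v\<in>V. if v \<in> fst p then 1 else 0)" by (rule sum.swap)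
  also have "\<dots> = (\<Sum>p\<in>Es. card (fst p \<inter> V))"
    using assms(1) by (intro sum.cong) (auto simp: sum.If_cases Int_commute)
  finally show ?thesis .
qed

lemma card_subsets_split:
  assumes "finite A" and "finite B" and "A \<inter> B = {}" and "a \<le> h"
  shows "card {Y. Y \<subseteq> A \<union> B \<and> card Y = h \<and> card (Y \<inter> A) = a}
    = (card A choose a) * (card B choose (h - a))"
proof -
  let ?P = "{S. S \<subseteq> A \<and> card S = a} \<times> {S. S \<subseteq> B \<and> card S = h - a}"
  have "bij_betw (\<lambda>(S, S'). S \<union> S') ?P {Y. Y \<subseteq> A \<union> B \<and> card Y = h \<and> card (Y \<inter> A) = a}"
  proof (rule bij_betw_byWitness[where f' = "\<lambda>Y. (Y \<inter> A, Y \<inter> B)"])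
    show "(\<lambda>(S, S'). S \<union> S') ` ?P \<subseteq> {Y. Y \<subseteq> A \<union> B \<and> card Y = h \<and> card (Y \<inter> A) = a}"
    proof (clarify, intro conjI)
      fix S S' assume S: "S \<subseteq> A" "S' \<subseteq> B" "card S' = h - card S" "a = card S"
      have "finite S" "finite S'" using S(1,2) assms(1,2) finite_subset by blast+
      moreover have "S \<inter> S' = {}" using S(1,2) assms(3) by blast
      ultimately show "card (S \<union> S') = h" using S(3,4) assms(4) by (simp add: card_Un_disjoint)
      have "(S \<union> S') \<inter> A = S" using S(1,2) assms(3) by blast
      then show "card ((S \<union> S') \<inter> A) = card S" by simp
    qed auto
    show "(\<lambda>Y. (Y \<inter> A, Y \<inter> B)) ` {Y. Y \<subseteq> A \<union> B \<and> card Y = h \<and> card (Y \<inter> A) = a} \<subseteq> ?P"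
    proof (rule image_subsetI)
      fix Y assume "Y \<in> {Y. Y \<subseteq> A \<union> B \<and> card Y = h \<and> card (Y \<inter> A) = a}"
      then have Y: "Y \<subseteq> A \<union> B" "card Y = h" "card (Y \<inter> A) = a" by auto
      have "card (Y \<inter> A \<union> Y \<inter> B) = card (Y \<inter> A) + card (Y \<inter> B)"
        using assms(1-3) by (intro card_Un_disjoint) auto
      moreover have "Y \<inter> A \<union> Y \<inter> B = Y" using Y(1) by blast
      ultimately show "(Y \<inter> A, Y \<inter> B) \<in> ?P" using Y by auto
    qed
  qed (use assms(3) in auto)
  then have "card {Y. Y \<subseteq> A \<union> B \<and> card Y = h \<and> card (Y \<inter> A) = a} = card ?P"
    by (simp add: bij_betw_same_card)
  also have "\<dots> = (card A choose a) * (card B choose (h - a))"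
    using assms(1,2) by (simp add: card_cartesian_product n_subsets)
  finally show ?thesis .
qed

text \<open>
  The vertex 1 lies in \<open>lam * ((m - 1) choose 3)\<close> edges, and in \<open>r\<close> of each color.
\<close>

lemma factorization_color_count:
  assumes fac: "factorization r lam m 4 q f" and "1 \<le> m"
  shows "r * q = lam * ((m - 1) choose 3)"
proof -
  have f: "f p \<in> {1..q}" if "p \<in> complete_edges lam m 4" for p
    using fac that unfolding factorization_def coloring_def by (blast dest: funcset_mem)
  let ?S = "{p \<in> complete_edges lam m 4. 1 \<in> fst p}"
  have "r * q = (\<Sum>j\<in>{1..q}. degree (color_class lam m 4 f j) 1)"
    using fac \<open>1 \<le> m\<close> by (simp add: factorization_def)
  also have "\<dots> = (\<Sum>j\<in>{1..q}. card {p\<in>?S. f p = j})"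
    unfolding degree_def color_class_def by (intro sum.cong arg_cong[of _ _ card]) auto
  also have "\<dots> = card ?S"
    unfolding card_eq_sum by (subst sum.group) (use f in auto)
  also have "?S = {Y. Y \<subseteq> {1} \<union> {2..m} \<and> card Y = 4 \<and> card (Y \<inter> {1}) = 1} \<times> {1..lam}"
  proof -
    have "{1..m} = {1} \<union> {2..m}" using \<open>1 \<le> m\<close> by auto
    moreover have "card (Y \<inter> {1 :: nat}) = 1 \<longleftrightarrow> 1 \<in> Y" for Y
      by (cases "1 \<in> Y") auto
    ultimately show ?thesis unfolding complete_edges_def by auto
  qed
  also have "card \<dots> = lam * ((m - 1) choose 3)"
    unfolding card_cartesian_product by (subst card_subsets_split) auto
  finally show ?thesis .
qed

lemma factorization_dvd:
  assumes fac: "factorization r lam m 4 q f" and "1 \<le> q"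
  shows "4 dvd r * m"
proof -
  let ?C = "color_class lam m 4 f 1"
  have "r * m = (\<Sum>v\<in>{1..m}. degree ?C v)"
    using fac \<open>1 \<le> q\<close> by (simp add: factorization_def)
  also have "\<dots> = (\<Sum>p\<in>?C. card (fst p \<inter> {1..m}))"
    by (rule sum_degree) (simp_all add: color_class_def)
  also have "\<dots> = (\<Sum>p\<in>?C. 4)"
    by (intro sum.cong) (auto simp: color_class_def complete_edges_def Int_absorb2)
  finally show ?thesis by simp
qed

text \<open>
  The new edges of color \<open>j\<close> have total degree \<open>missing_degree r s q j * m\<close> in \<open>[m]\<close> and
  \<open>s * (n - m)\<close> outside; each edge counts four times in the sum.
\<close>

definition color_size :: "nat \<Rightarrow> nat \<Rightarrow> nat \<Rightarrow> nat \<Rightarrow> nat \<Rightarrow> nat \<Rightarrow> int" where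
  "color_size r s m n q j = int ((missing_degree r s q j * m + s * (n - m)) div 4)"

text \<open>
  Counting the new edges of each color by type solves the equations; \<open>D\<close> and \<open>D'\<close> below are double
  counts of the incidences with \<open>[m]\<close> and with its complement.
\<close>

lemma edge_split_of_extension:
  assumes mn: "1 \<le> m" "m < n" and q: "1 \<le> q" "q \<le> q'"
    and facf: "factorization r lam m 4 q f" and facg: "factorization s lam n 4 q' g"
    and ext: "\<And>p. p \<in> complete_edges lam m 4 \<Longrightarrow> g p = f p"
  shows "r \<le> s"
    and "edge_split {1..q'} (\<lambda>j. int (missing_degree r s q j * m)) (color_size r s m n q)
      (edge_types lam m n)"
proof -
  define old where "old = color_class lam m 4 f"
  define C where "C = color_class lam n 4 g"
  define N where "N = (\<lambda>j. {p\<in>C j. \<not> fst p \<subseteq> {1..m}})"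
  define \<kappa> where "\<kappa> = (\<lambda>p :: edge. card (fst p \<inter> {1..m}))"
  define e where "e = (\<lambda>j a. card {p\<in>N j. \<kappa> p = a})"
  have f: "f p \<in> {1..q}" if "p \<in> complete_edges lam m 4" for p
    using facf that unfolding factorization_def coloring_def by (blast dest: funcset_mem)
  have g: "g p \<in> {1..q'}" if "p \<in> complete_edges lam n 4" for p
    using facg that unfolding factorization_def coloring_def by (blast dest: funcset_mem)
  have fin: "finite (old j)" "finite (C j)" "finite (N j)" for j
    by (simp_all add: old_def C_def N_def color_class_def)
  have old: "{p\<in>C j. fst p \<subseteq> {1..m}} = old j" for j
    using mn ext unfolding C_def old_def color_class_def complete_edges_def by auto
  have CN: "C j = N j \<union> old j" "N j \<inter> old j = {}" for j
    unfolding old[symmetric] N_def by auto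
  have sumC: "(\<Sum>p\<in>C j. \<phi> p) = (\<Sum>p\<in>N j. \<phi> p) + (\<Sum>p\<in>old j. \<phi> p)" for j and \<phi> :: "edge \<Rightarrow> nat"
    unfolding CN(1)[of j] using CN(2) fin by (simp add: sum.union_disjoint)
  have degC: "degree (C j) v = s" if "j \<in> {1..q'}" "v \<in> {1..n}" for j v
    using facg that by (simp add: factorization_def C_def)
  have degold: "degree (old j) v = (if j \<le> q then r else 0)" if "j \<in> {1..q'}" "v \<in> {1..m}" for j v
  proof (cases "j \<le> q")
    case True
    then show ?thesis using facf that by (simp add: factorization_def old_def)
  next
    case False
    then have "old j = {}" using f by (force simp: old_def color_class_def)
    then show ?thesis using False by (simp add: degree_def)
  qed
  have one: "1 \<in> {1..q'}" "1 \<in> {1..m}" "1 \<in> {1..n}" using mn q by auto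
  have "degree (old 1) 1 \<le> degree (C 1) 1"
    unfolding degree_def using CN(1)[of 1] fin by (intro card_mono) auto
  then show rs: "r \<le> s" using degold[OF one(1,2)] degC[OF one(1,3)] q by simp
  have \<kappa>4: "\<kappa> p + card (fst p \<inter> {m+1..n}) = 4" if "p \<in> C j" for p j
  proof -
    have p: "fst p \<subseteq> {1..n}" "card (fst p) = 4"
      using that by (auto simp: C_def color_class_def complete_edges_def)
    have "fst p \<inter> {1..m} \<union> fst p \<inter> {m+1..n} = fst p" using p(1) by auto
    moreover have "card (fst p \<inter> {1..m} \<union> fst p \<inter> {m+1..n}) = \<kappa> p + card (fst p \<inter> {m+1..n})"
      unfolding \<kappa>_def by (intro card_Un_disjoint) auto
    ultimately show ?thesis using p(2) by simp
  qed
  have \<kappa>3: "\<kappa> p \<le> 3" if "p \<in> N j" for p j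
  proof -
    have p: "p \<in> C j" "fst p \<subseteq> {1..n}" "\<not> fst p \<subseteq> {1..m}"
      using that by (auto simp: N_def C_def color_class_def complete_edges_def)
    then obtain v where "v \<in> fst p \<inter> {m+1..n}" by force
    then have "card (fst p \<inter> {m+1..n}) \<noteq> 0" by auto
    then show ?thesis using \<kappa>4[OF p(1)] by linarith
  qed
  have group: "(\<Sum>p\<in>N j. \<phi> (\<kappa> p)) = (\<Sum>a\<le>3. e j a * \<phi> a)" for j and \<phi> :: "nat \<Rightarrow> nat"
  proof -
    have "(\<Sum>p\<in>N j. \<phi> (\<kappa> p)) = (\<Sum>a\<le>3. \<Sum>p\<in>{p\<in>N j. \<kappa> p = a}. \<phi> (\<kappa> p))"
      using fin \<kappa>3 by (intro sum.group[symmetric]) auto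
    also have "\<dots> = (\<Sum>a\<le>3. e j a * \<phi> a)" by (simp add: e_def)
    finally show ?thesis .
  qed
  have D: "(\<Sum>a\<le>3. e j a * a) = missing_degree r s q j * m" if j: "j \<in> {1..q'}" for j
  proof -
    have "(\<Sum>p\<in>C j. \<kappa> p) = (\<Sum>v\<in>{1..m}. degree (C j) v)"
      unfolding \<kappa>_def using fin by (subst sum_degree) auto
    also have "\<dots> = s * m" using degC[OF j] mn by simp
    finally have "(\<Sum>p\<in>N j. \<kappa> p) + (\<Sum>p\<in>old j. \<kappa> p) = s * m" by (simp only: sumC)
    moreover have "(\<Sum>p\<in>old j. \<kappa> p) = (\<Sum>v\<in>{1..m}. degree (old j) v)"
      unfolding \<kappa>_def using fin by (subst sum_degree) auto
    moreover have "\<dots> = (if j \<le> q then r else 0) * m" using degold[OF j] by simp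
    ultimately show ?thesis using group[of "\<lambda>a. a" j] rs
      by (auto simp: missing_degree_def diff_mult_distrib)
  qed
  have D': "(\<Sum>a\<le>3. e j a * (4 - a)) = s * (n - m)" if j: "j \<in> {1..q'}" for j
  proof -
    have "(\<Sum>p\<in>C j. card (fst p \<inter> {m+1..n})) = (\<Sum>v\<in>{m+1..n}. degree (C j) v)"
      using fin by (subst sum_degree) auto
    also have "\<dots> = s * (n - m)" using degC[OF j] mn by simp
    finally have "(\<Sum>p\<in>N j. card (fst p \<inter> {m+1..n})) + (\<Sum>p\<in>old j. card (fst p \<inter> {m+1..n})) = s * (n - m)"
      by (simp only: sumC)
    moreover have "(\<Sum>p\<in>old j. card (fst p \<inter> {m+1..n})) = 0"
    proof (rule sum.neutral, rule ballI)
      fix p assume "p \<in> old j"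
      then have "fst p \<inter> {m+1..n} = {}" unfolding old[symmetric] by force
      then show "card (fst p \<inter> {m+1..n}) = 0" by (simp only: card.empty)
    qed
    moreover have "(\<Sum>p\<in>N j. card (fst p \<inter> {m+1..n})) = (\<Sum>p\<in>N j. 4 - \<kappa> p)"
    proof (rule sum.cong[OF refl])
      fix p assume "p \<in> N j"
      then have "\<kappa> p + card (fst p \<inter> {m+1..n}) = 4" by (intro \<kappa>4[of p j]) (simp add: N_def)
      then show "card (fst p \<inter> {m+1..n}) = 4 - \<kappa> p" by linarith
    qed
    ultimately show ?thesis using group[of "\<lambda>a. 4 - a" j] by linarith
  qed
  have E: "int (\<Sum>a\<le>3. e j a) = color_size r s m n q j" if "j \<in> {1..q'}" for j
  proof -
    have "(\<Sum>a\<le>3. e j a * a) + (\<Sum>a\<le>3. e j a * (4 - a)) = 4 * (\<Sum>a\<le>3. e j a)"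
      by (simp add: sum_upto_3)
    then have "missing_degree r s q j * m + s * (n - m) = 4 * (\<Sum>a\<le>3. e j a)"
      using D[OF that] D'[OF that] by simp
    then show ?thesis by (simp add: color_size_def)
  qed
  have T: "int (\<Sum>j\<in>{1..q'}. e j a) = edge_types lam m n a" if a: "a \<le> 3" for a
  proof -
    let ?S = "{p \<in> complete_edges lam n 4. \<kappa> p = a}"
    have "(\<Sum>j\<in>{1..q'}. e j a) = (\<Sum>j\<in>{1..q'}. card {p\<in>?S. g p = j})"
    proof (intro sum.cong refl arg_cong[of _ _ card] Collect_cong)
      show "e j a = card {p\<in>?S. g p = j}" for j
        unfolding e_def
      proof (intro arg_cong[of _ _ card] Collect_cong iffI)
        fix p assume "p \<in> ?S \<and> g p = j"
        then have p: "p \<in> C j" "\<kappa> p = a" "card (fst p) = 4"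
          by (auto simp: C_def color_class_def complete_edges_def)
        have "\<not> fst p \<subseteq> {1..m}"
        proof
          assume "fst p \<subseteq> {1..m}"
          then have "\<kappa> p = card (fst p)" by (simp add: \<kappa>_def Int_absorb2)
          then show False using p a by simp
        qed
        then show "p \<in> N j \<and> \<kappa> p = a" using p by (simp add: N_def)
      qed (auto simp: N_def C_def color_class_def)
    qed
    also have "\<dots> = card ?S"
      unfolding card_eq_sum by (subst sum.group) (use g in auto)
    also have "?S = {Y. Y \<subseteq> {1..m} \<union> {m+1..n} \<and> card Y = 4 \<and> card (Y \<inter> {1..m}) = a} \<times> {1..lam}"
    proof -
      have "{1..n} = {1..m} \<union> {m+1..n}" using mn by auto
      then show ?thesis unfolding complete_edges_def \<kappa>_def by auto
    qed
    also have "card \<dots> = (m choose a) * ((n - m) choose (4 - a)) * lam"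
      unfolding card_cartesian_product using a by (subst card_subsets_split) auto
    finally show ?thesis by (simp add: edge_types_def)
  qed
  show "edge_split {1..q'} (\<lambda>j. int (missing_degree r s q j * m)) (color_size r s m n q)
      (edge_types lam m n)"
    unfolding edge_split_def
  proof (intro exI[of _ e] conjI ballI allI impI)
    show "(\<Sum>a\<le>3. int (e j a)) = color_size r s m n q j" if "j \<in> {1..q'}" for j
      using E[OF that] by simp
    show "(\<Sum>a\<le>3. int a * int (e j a)) = int (missing_degree r s q j * m)" if "j \<in> {1..q'}" for j
      unfolding D[OF that, symmetric] by (simp add: mult.commute)
    show "(\<Sum>j\<in>{1..q'}. int (e j a)) = edge_types lam m n a" if "a \<le> 3" for a
      using T[OF that] by simp
  qed
qed

section \<open>The arithmetic of the four conditions\<close>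

text \<open>
  Over the integers the polynomial forms of the binomial coefficients hold also for small arguments.
\<close>

lemma int_choose_2: "2 * int (x choose 2) = int x * (int x - 1)"
  by (induction x) (auto simp: eval_nat_numeral algebra_simps)

lemma int_choose_3: "6 * int (x choose 3) = int x * (int x - 1) * (int x - 2)"
proof (induction x)
  case (Suc x)
  have "6 * int (Suc x choose 3) = 3 * (2 * int (x choose 2)) + 6 * int (x choose 3)"
    by (simp add: eval_nat_numeral)
  then show ?case unfolding Suc int_choose_2 by (simp add: algebra_simps)
qed simp

lemma int_choose_4: "24 * int (x choose 4) = int x * (int x - 1) * (int x - 2) * (int x - 3)"
proof (induction x)
  case (Suc x)
  have "24 * int (Suc x choose 4) = 4 * (6 * int (x choose 3)) + 24 * int (x choose 4)"
    by (simp add: eval_nat_numeral)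
  then show ?case unfolding Suc int_choose_3 by (simp add: algebra_simps)
qed simp

text \<open>
  The following estimates compare, for \<open>p = n - m\<close>, the cubic \<open>6 * ((n - 1) choose 3)\<close> with numbers
  of edges of given types (the digits in the names are the types that occur on the right). They say that
  there are enough edges of these types for every color to have one or two, the factors \<open>lam\<close> and
  \<open>s\<close> being supplied later; the last one does so for the old colors, with
  \<open>6 * ((m - 1) choose 3)\<close> on the left. Each is proved by
  substituting the lower bounds on \<open>m\<close> and \<open>p\<close>, which leaves a polynomial without negative
  coefficients; where the ratio of \<open>m\<close> and \<open>p\<close> must be bounded, a multiple of the corresponding
  nonnegative difference is split off first.
\<close>

lemma cubic_le_types_2:
  fixes m p :: int
  assumes "4 \<le> m" "m \<le> p" "p \<le> 3 * m"
  shows "(m + p - 1) * (m + p - 2) * (m + p - 3) \<le> 3 * m * (m - 1) * p * (p - 1)"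
proof -
  define x d where "x = m - 4" and "d = p - m"
  then have m: "m = x + 4" "p = x + 4 + d" and nn: "0 \<le> x" "0 \<le> d" "0 \<le> 2 * m - d"
    using assms by auto
  have "3 * m * (m - 1) * p * (p - 1) - (m + p - 1) * (m + p - 2) * (m + p - 3) = d^2 * (2 * m - d) +
    (3*x^4 + 6*x^3*d + 34*x^3 + 3*x^2*d^2 + 51*x^2*d + 147*x^2 + 13*x*d^2 + 147*x*d + 290*x + 10*d^2 + 145*d + 222)"
    unfolding m by algebra
  also have "\<dots> \<ge> 0" using nn by (intro add_nonneg_nonneg mult_nonneg_nonneg zero_le_power) auto
  finally show ?thesis by simp
qed

lemma cubic_le_types_2_large:
  fixes m p :: int
  assumes "8 \<le> m" "m \<le> p" "p \<le> 3 * m"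
  shows "2 * ((m + p - 1) * (m + p - 2) * (m + p - 3)) \<le> 3 * m * (m - 1) * p * (p - 1)"
proof -
  define x d where "x = m - 8" and "d = p - m"
  then have m: "m = x + 8" "p = x + 8 + d" and nn: "0 \<le> x" "0 \<le> d" "0 \<le> 2 * m - d"
    using assms by auto
  have "3 * m * (m - 1) * p * (p - 1) - 2 * ((m + p - 1) * (m + p - 2) * (m + p - 3)) = 2 * d^2 * (2 * m - d) +
    (3*x^4 + 6*x^3*d + 74*x^3 + 3*x^2*d^2 + 111*x^2*d + 675*x^2 + 29*x*d^2 + 675*x*d + 2692*x + 52*d^2 + 1346*d + 3948)"
    unfolding m by algebra
  also have "\<dots> \<ge> 0" using nn by (intro add_nonneg_nonneg mult_nonneg_nonneg zero_le_power) auto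
  finally show ?thesis by simp
qed

lemma cubic_le_types_12:
  fixes m p :: int
  assumes "4 \<le> m" "m \<le> p"
  shows "(m + p - 1) * (m + p - 2) * (m + p - 3) \<le> m * p * (p - 1) * (p - 2) + 3 * m * (m - 1) * p * (p - 1)"
proof -
  define x d where "x = m - 4" and "d = p - m"
  then have m: "m = x + 4" "p = x + 4 + d" and nn: "0 \<le> x" "0 \<le> d"
    using assms by auto
  have "2 * (m * p * (p - 1) * (p - 2) + 3 * m * (m - 1) * p * (p - 1)) -
      2 * ((m + p - 1) * (m + p - 2) * (m + p - 3)) =
    8*x^4 + 18*x^3*d + 94*x^3 + 12*x^2*d^2 + 162*x^2*d + 418*x^2 + 2*x*d^3 + 72*x*d^2 + 490*x*d + 836*x + 6*d^3 + 108*d^2 + 498*d + 636"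
    unfolding m by algebra
  also have "\<dots> \<ge> 0" using nn by (intro add_nonneg_nonneg mult_nonneg_nonneg zero_le_power) auto
  finally show ?thesis by simp
qed

lemma cubic_le_types_12_large:
  fixes m p :: int
  assumes "8 \<le> m" "m \<le> p"
  shows "2 * ((m + p - 1) * (m + p - 2) * (m + p - 3)) \<le> m * p * (p - 1) * (p - 2) + 3 * m * (m - 1) * p * (p - 1)"
proof -
  define x d where "x = m - 8" and "d = p - m"
  then have m: "m = x + 8" "p = x + 8 + d" and nn: "0 \<le> x" "0 \<le> d"
    using assms by auto
  have "m * p * (p - 1) * (p - 2) + 3 * m * (m - 1) * p * (p - 1) -
      2 * ((m + p - 1) * (m + p - 2) * (m + p - 3)) =
    4*x^4 + 9*x^3*d + 103*x^3 + 6*x^2*d^2 + 177*x^2*d + 989*x^2 + 1*x*d^3 + 78*x*d^2 + 1157*x*d + 4196*x + 6*d^3 + 252*d^2 + 2514*d + 6636"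
    unfolding m by algebra
  also have "\<dots> \<ge> 0" using nn by (intro add_nonneg_nonneg mult_nonneg_nonneg zero_le_power) auto
  finally show ?thesis by simp
qed

lemma cubic_le_types_1:
  fixes m p :: int
  assumes "4 \<le> m" "m \<le> p"
  shows "(m + p - 1) * (m + p - 2) * (m + p - 3) \<le> 5 * (m * p * (p - 1) * (p - 2))"
proof -
  define x d where "x = m - 4" and "d = p - m"
  then have m: "m = x + 4" "p = x + 4 + d" and nn: "0 \<le> x" "0 \<le> d"
    using assms by auto
  have "5 * (m * p * (p - 1) * (p - 2)) - (m + p - 1) * (m + p - 2) * (m + p - 3) =
    5*x^4 + 15*x^3*d + 57*x^3 + 15*x^2*d^2 + 138*x^2*d + 238*x^2 + 5*x*d^3 + 99*x*d^2 + 418*x*d + 426*x + 19*d^3 + 162*d^2 + 413*d + 270"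
    unfolding m by algebra
  also have "\<dots> \<ge> 0" using nn by (intro add_nonneg_nonneg mult_nonneg_nonneg zero_le_power) auto
  finally show ?thesis by simp
qed

lemma cubic_le_types_12_short:
  fixes m p :: int
  assumes "4 \<le> p" "p \<le> m" "m \<le> 3 * p"
  shows "2 * ((m + p - 1) * (m + p - 2) * (m + p - 3)) \<le>
    4 * (m * p * (p - 1) * (p - 2)) + 3 * m * (m - 1) * p * (p - 1)"
proof -
  define x d where "x = p - 4" and "d = m - p"
  then have m: "p = x + 4" "m = x + 4 + d" and nn: "0 \<le> x" "0 \<le> d" "0 \<le> 2 * p - d"
    using assms by auto
  have "4 * (m * p * (p - 1) * (p - 2)) + 3 * m * (m - 1) * p * (p - 1) -
      2 * ((m + p - 1) * (m + p - 2) * (m + p - 3)) = 2 * d^2 * (2 * p - d) + 16 * d * (2 * p - d) +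
    (7*x^4 + 10*x^3*d + 78*x^3 + 3*x^2*d^2 + 75*x^2*d + 323*x^2 + 5*x*d^2 + 147*x*d + 588*x + 6*d + 396)"
    unfolding m by algebra
  also have "\<dots> \<ge> 0" using nn by (intro add_nonneg_nonneg mult_nonneg_nonneg zero_le_power) auto
  finally show ?thesis by simp
qed

lemma cubic_le_types_1_short:
  fixes m p :: int
  assumes "4 \<le> p" "4 \<le> m" "m \<le> 3 * p"
  shows "(m - 1) * (m - 2) * (m - 3) \<le> 4 * (m * p * (p - 1) * (p - 2))"
proof -
  define x where "x = p - 4"
  then have p: "p = x + 4" and nn: "0 \<le> x" "0 \<le> m" "0 \<le> 3 * p - m" "0 \<le> 3 * p + m - 6"
    using assms by auto
  have "4 * (m * p * (p - 1) * (p - 2)) - (m - 1) * (m - 2) * (m - 3) =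
      m * ((3 * p - m) * (3 * p + m - 6) + (4*x^3 + 27*x^2 + 50*x + 13)) + 6"
    unfolding p by algebra
  also have "\<dots> \<ge> 0" using nn by (intro add_nonneg_nonneg mult_nonneg_nonneg zero_le_power) auto
  finally show ?thesis by simp
qed

text \<open>
  The criterion for old colors with parameters \<open>D1\<close>, \<open>E1\<close> and new colors with parameters \<open>D2\<close>,
  \<open>E2\<close>. Rounding \<open>D j / 3\<close> down loses at most 2/3 per color, so the bound \<open>x j \<le> D j div 3\<close> leaves
  room for all edges of type 3 as soon as \<open>2 * q' \<le> T 1 + 2 * T 2\<close>.
\<close>

lemma edge_split_two_sizes:
  fixes D1 D2 E1 E2 :: int and T :: "nat \<Rightarrow> int" and q q' :: nat
  defines "k \<equiv> int q' - int q"
  assumes q: "q \<le> q'"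
    and D: "\<And>j. D j = (if j \<le> q then D1 else D2)" and E: "\<And>j. E j = (if j \<le> q then E1 else E2)"
    and D0: "0 \<le> D1" "0 \<le> D2" and DE: "D1 \<le> 3 * E1" "D2 \<le> 3 * E2"
    and sumE: "int q * E1 + k * E2 = T 0 + T 1 + T 2 + T 3"
    and sumD: "int q * D1 + k * D2 = T 1 + 2 * T 2 + 3 * T 3"
    and low: "int q * max 0 (D1 - 2 * E1) + k * max 0 (D2 - 2 * E2) \<le> T 3"
    and mid: "int q * max 0 (D1 - E1) + k * max 0 (D2 - E2) \<le> 2 * T 3 + T 2"
    and high: "T 3 = 0 \<or> 2 * int q' \<le> T 1 + 2 * T 2"
    and parity: "int q' \<le> T 1 \<or> even D1 \<and> even D2 \<and> T 3 \<le> T 1"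
    and odd_c: "0 < T 3 \<Longrightarrow> (if odd (max 0 (D1 - E1)) then int q else 0)
      + (if odd (max 0 (D2 - E2)) then k else 0) \<le> T 2"
  shows "edge_split {1..q'} D E T"
proof -
  have sum2: "(\<Sum>j\<in>{1..q'}. if j \<le> q then a else b) = int q * a + k * b" for a b :: int
  proof -
    have "{1..q'} \<inter> {j. j \<le> q} = {1..q}" "{1..q'} \<inter> - {j. j \<le> q} = {q+1..q'}" using q by auto
    then show ?thesis using q by (simp add: sum.If_cases k_def of_nat_diff)
  qed
  have nn: "0 \<le> int q" "0 \<le> k" using q by (auto simp: k_def)
  have split_if: "G (D j) (E j) = (if j \<le> q then G D1 E1 else G D2 E2)" for G :: "int \<Rightarrow> int \<Rightarrow> int" and j
    unfolding D E by simp
  have sumG: "(\<Sum>j\<in>{1..q'}. G (D j) (E j)) = int q * G D1 E1 + k * G D2 E2" for G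
    unfolding split_if sum2 ..
  have card_odd: "int (card {j\<in>{1..q'}. odd (max 0 (D j - E j))}) =
      (if odd (max 0 (D1 - E1)) then int q else 0) + (if odd (max 0 (D2 - E2)) then k else 0)"
  proof -
    have "int (card {j\<in>{1..q'}. odd (max 0 (D j - E j))}) = (\<Sum>j\<in>{1..q'}. if odd (max 0 (D j - E j)) then 1 else 0)"
      by (simp add: sum.If_cases Int_def)
    then show ?thesis using sumG[of "\<lambda>d e. if odd (max 0 (d - e)) then 1 else 0"] by simp
  qed
  show ?thesis
  proof (rule edge_split_exists)
    show "T 3 \<le> (\<Sum>j\<in>{1..q'}. D j div 3)"
      unfolding sumG[of "\<lambda>d e. d div 3"] using high
    proof
      assume "2 * int q' \<le> T 1 + 2 * T 2"
      moreover have "int q * (D1 - 2) \<le> int q * (3 * (D1 div 3))"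
        using nn by (intro mult_left_mono) auto
      moreover have "k * (D2 - 2) \<le> k * (3 * (D2 div 3))"
        using nn by (intro mult_left_mono) auto
      moreover have "int q + k = int q'" by (simp add: k_def)
      ultimately show "T 3 \<le> int q * (D1 div 3) + k * (D2 div 3)"
        using sumD by (simp add: algebra_simps)
    next
      assume "T 3 = 0"
      then show "T 3 \<le> int q * (D1 div 3) + k * (D2 div 3)"
        using nn D0 by (simp add: pos_imp_zdiv_nonneg_iff)
    qed
    show "int (card {1..q'}) \<le> T 1 \<or> (\<forall>j\<in>{1..q'}. even (D j)) \<and> T 3 \<le> T 1"
      using parity by (auto simp: D)
    show "int (card {j\<in>{1..q'}. odd (max 0 (D j - E j))}) \<le> T 2"
      if "(\<Sum>j\<in>{1..q'}. max 0 (D j - E j) div 2) < T 3"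
    proof -
      have "0 \<le> (\<Sum>j\<in>{1..q'}. max 0 (D j - E j) div 2)"
        by (intro sum_nonneg) (simp add: pos_imp_zdiv_nonneg_iff)
      then show ?thesis unfolding card_odd using that by (intro odd_c) linarith
    qed
  qed (use assms(3-) sumG[of "\<lambda>d e. e"] sumG[of "\<lambda>d e. d"] sumG[of "\<lambda>d e. max 0 (d - 2 * e)"]
      sumG[of "\<lambda>d e. max 0 (d - e)"] in \<open>simp_all add: D E\<close>)
qed

lemma edge_types_polynomials:
  fixes m n lam :: nat
  assumes "m \<le> n"
  defines "M \<equiv> int m" and "P \<equiv> int n - int m" and "L \<equiv> int lam"
  shows "6 * edge_types lam m n 3 = L * (P * M * (M - 1) * (M - 2))"
    and "4 * edge_types lam m n 2 = L * (M * (M - 1) * P * (P - 1))"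
    and "6 * edge_types lam m n 1 = L * (M * P * (P - 1) * (P - 2))"
    and "24 * edge_types lam m n 0 = L * (P * (P - 1) * (P - 2) * (P - 3))"
proof -
  have P: "int (n - m) = P" using assms(1) by (simp add: P_def of_nat_diff)
  show "6 * edge_types lam m n 3 = L * (P * M * (M - 1) * (M - 2))"
    using int_choose_3[of m] P by (simp add: edge_types_def L_def M_def)
  have "4 * edge_types lam m n 2 = L * (2 * int (m choose 2)) * (2 * int ((n - m) choose 2))"
    by (simp add: edge_types_def L_def)
  then show "4 * edge_types lam m n 2 = L * (M * (M - 1) * P * (P - 1))"
    unfolding int_choose_2 P by (simp add: M_def)
  have "6 * edge_types lam m n 1 = L * M * (6 * int ((n - m) choose 3))"
    by (simp add: edge_types_def L_def M_def)
  then show "6 * edge_types lam m n 1 = L * (M * P * (P - 1) * (P - 2))"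
    unfolding int_choose_3 P by simp
  have "24 * edge_types lam m n 0 = L * (24 * int ((n - m) choose 4))"
    by (simp add: edge_types_def L_def)
  then show "24 * edge_types lam m n 0 = L * (P * (P - 1) * (P - 2) * (P - 3))"
    unfolding int_choose_4 P by simp
qed

lemma color_size_times_4:
  assumes "m \<le> n" "r \<le> s" "4 dvd r * m" "4 dvd s * n"
  shows "4 * color_size r s m n q j = int (missing_degree r s q j * m + s * (n - m))"
proof -
  have sn: "s * n = s * m + s * (n - m)" using assms(1) by (simp add: diff_mult_distrib2)
  have "4 dvd missing_degree r s q j * m + s * (n - m)"
  proof (cases "j \<le> q")
    case True
    then have "missing_degree r s q j * m + s * (n - m) = s * n - r * m"
      using sn assms(2) by (simp add: missing_degree_def diff_mult_distrib)
    then show ?thesis using assms(3,4) by (simp add: dvd_diff_nat)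
  qed (use sn assms(4) in \<open>simp add: missing_degree_def\<close>)
  then obtain c where c: "missing_degree r s q j * m + s * (n - m) = 4 * c" by (elim dvdE)
  show ?thesis unfolding color_size_def c by simp
qed

text \<open>
  The hypotheses \<open>three\<close> and \<open>four\<close> are the last two conditions of the theorem multiplied by
  \<open>2 * lam\<close> and \<open>4 * lam\<close>; they say that \<open>k * (D2 - 2 * E2) \<le> T 3\<close> and
  \<open>k * (D2 - E2) \<le> 2 * T 3 + T 2\<close> for the \<open>k\<close> new colors. If an old color
  also has a positive bound of this kind, then so do the new ones, and the sum of the bounds over all
  colors is at most the total by the equations alone. What remains are the rounding conditions.

  If \<open>n \<ge> 2 * m\<close>, then \<open>T 3 \<le> T 1\<close>, which settles the rounding of the upper bound for even
  \<open>D1\<close>, \<open>D2\<close>; if one of them is odd, then \<open>m\<close> and \<open>s\<close> are odd and \<open>4 dvd r\<close>, hence \<open>s \<ge> 5\<close>, and there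
  are so few colors that \<open>q' \<le> T 1\<close>. If \<open>n < 2 * m\<close>, then \<open>s > r\<close>, hence \<open>s \<ge> 2\<close>,
  and the reversed problem is solved: there \<open>T 2\<close> is large enough for the rounding of the upper bound,
  and only old colors with odd \<open>D1\<close> can lose in the lower one, for which \<open>4 dvd r\<close> again. The
  bounds \<open>s \<ge> 2\<close> or \<open>m \<ge> 8\<close> in the first case use that \<open>s = 1\<close> forces \<open>r = 1\<close> and \<open>4 dvd m\<close>.
\<close>

lemma edge_split_if_conditions:
  fixes m n r s lam q q' :: nat
  defines "M \<equiv> int m" and "P \<equiv> int n - int m" and "k \<equiv> int q' - int q" and "T \<equiv> edge_types lam m n"
  assumes m4: "4 \<le> m" "m < n" and rs: "1 \<le> r" "r \<le> s" and exc: "m = 4 \<Longrightarrow> 2 \<le> r"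
    and dvd4: "4 dvd r * m" "4 dvd s * n"
    and rq: "r * q = lam * ((m - 1) choose 3)" and sq: "s * q' = lam * ((n - 1) choose 3)"
    and q: "q \<le> q'"
    and two: "s = r \<Longrightarrow> 2 * m \<le> n" "4 * m \<le> 3 * n"
    and three: "k * (int s * (M - P)) \<le> 2 * T 3"
    and four: "k * (int s * (3 * M - P)) \<le> 4 * (2 * T 3 + T 2)"
  shows "edge_split {1..q'} (\<lambda>j. int (missing_degree r s q j * m)) (color_size r s m n q) T"
proof -
  have r4: "4 dvd r" if "odd m"
  proof -
    have "coprime (2 ^ 2) m" unfolding coprime_power_left_iff using that by simp
    then show ?thesis using dvd4(1) by (simp add: coprime_dvd_mult_left_iff)
  qed
  define S R L Q Q' where "S = int s" and "R = int r" and "L = int lam" and "Q = int q" and "Q' = int q'"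
  define D1 D2 W where "D1 = M * (S - R)" and "D2 = M * S" and "W = S * P"
  define E1 E2 where "E1 = (D1 + W) div 4" and "E2 = (D2 + W) div 4"
  define D E where "D = (\<lambda>j. int (missing_degree r s q j * m))" and "E = color_size r s m n q"
  have D: "D j = (if j \<le> q then D1 else D2)" for j
    using rs by (simp add: D_def D1_def D2_def missing_degree_def S_def R_def M_def of_nat_diff)
  have W: "int (s * (n - m)) = W" using m4 by (simp add: W_def S_def P_def of_nat_diff)
  have E4: "4 * E j = D j + W" for j
    using color_size_times_4[of m n r s q j] m4 rs dvd4 W by (simp add: E_def D_def)
  have E: "E j = (if j \<le> q then E1 else E2)" for j
    using E4[of j] unfolding D E1_def E2_def by auto
  have E12: "4 * E1 = D1 + W" "4 * E2 = D2 + W"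
    using E4[of q] E4[of "Suc q"] unfolding E D by auto
  have kQ: "k = Q' - Q" by (simp add: k_def Q'_def Q_def)
  have pos: "0 \<le> L" "0 < S" "0 < R" "R \<le> S" "0 \<le> Q" "0 \<le> k" "4 \<le> M" "1 \<le> P" "M \<le> 3 * P"
    "0 \<le> M" "0 \<le> P"
    using rs m4 two q by (auto simp: L_def S_def R_def Q_def k_def M_def P_def)
  note T6 = edge_types_polynomials[of m n lam, folded M_def P_def L_def T_def]
  have T3: "6 * T 3 = L * (P * M * (M - 1) * (M - 2))"
    and T2: "4 * T 2 = L * (M * (M - 1) * P * (P - 1))"
    and T1: "6 * T 1 = L * (M * P * (P - 1) * (P - 2))"
    and T0: "24 * T 0 = L * (P * (P - 1) * (P - 2) * (P - 3))"
    using T6 m4 by simp_all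
  have Tnn: "0 \<le> T a" for a by (simp add: T_def edge_types_def)
  define M3 N3 where "M3 = (M - 1) * (M - 2) * (M - 3)" and "N3 = (M + P - 1) * (M + P - 2) * (M + P - 3)"
  have rq6: "6 * (R * Q) = L * M3"
  proof -
    have "6 * (R * Q) = L * (6 * int ((m - 1) choose 3))"
      unfolding R_def Q_def L_def by (metis mult.left_commute of_nat_mult rq)
    then show ?thesis unfolding int_choose_3 using m4 by (simp add: M3_def M_def of_nat_diff)
  qed
  have sq6: "6 * (S * Q') = L * N3"
  proof -
    have "6 * (S * Q') = L * (6 * int ((n - 1) choose 3))"
      unfolding S_def Q'_def L_def by (metis mult.left_commute of_nat_mult sq)
    then show ?thesis unfolding int_choose_3 using m4 by (simp add: N3_def M_def P_def of_nat_diff)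
  qed
  have sumD: "Q * D1 + k * D2 = T 1 + 2 * T 2 + 3 * T 3"
  proof -
    have "6 * (Q * D1 + k * D2) = M * (6 * (S * Q') - 6 * (R * Q))"
      unfolding D1_def D2_def kQ by algebra
    also have "\<dots> = 6 * T 1 + 3 * (4 * T 2) + 3 * (6 * T 3)"
      unfolding rq6 sq6 T1 T2 T3 M3_def N3_def by algebra
    finally show ?thesis by simp
  qed
  have sumE: "Q * E1 + k * E2 = T 0 + T 1 + T 2 + T 3"
  proof -
    have "24 * (Q * E1 + k * E2) = 6 * (Q * (4 * E1) + k * (4 * E2))" by algebra
    also have "\<dots> = 6 * (Q * D1 + k * D2) + P * (6 * (S * Q'))"
      unfolding E12 W_def kQ by algebra
    also have "P * (6 * (S * Q')) = 24 * T 0 + 3 * (6 * T 1) + 3 * (4 * T 2) + 6 * T 3"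
      unfolding sq6 T0 T1 T2 T3 N3_def by algebra
    finally show ?thesis unfolding sumD by simp
  qed
  \<comment> \<open>Turns the polynomial estimates into bounds for the number of colors.\<close>
  have few_colors: "c * (6 * Q') \<le> L * X" if "c * N3 \<le> S * X" for c X
  proof -
    have "S * (c * (6 * Q')) = L * (c * N3)" using sq6 by algebra
    also have "\<dots> \<le> L * (S * X)" using that pos by (intro mult_left_mono) auto
    also have "\<dots> = S * (L * X)" by simp
    finally show ?thesis using pos by simp
  qed
  define Y1 Y2 where "Y1 = M * P * (P - 1) * (P - 2)" and "Y2 = 3 * M * (M - 1) * P * (P - 1)"
  have Ynn: "0 \<le> Y1" "0 \<le> Y2"
  proof -
    have "0 \<le> (P - 1) * (P - 2)"
      using pos by (cases "P = 1") (auto intro: mult_nonneg_nonneg)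
    then have "0 \<le> M * P * ((P - 1) * (P - 2))" using pos by (intro mult_nonneg_nonneg) auto
    then show "0 \<le> Y1" by (simp add: Y1_def mult.assoc)
    show "0 \<le> Y2" unfolding Y2_def using pos by (intro mult_nonneg_nonneg) auto
  qed
  have scale: "c * Y \<le> S * Y" if "c \<le> S" "0 \<le> Y" for c Y
    using that by (rule mult_right_mono)
  have D12: "D1 \<le> D2" "0 \<le> D1" "D2 \<le> 3 * W"
  proof -
    show "D1 \<le> D2" unfolding D1_def D2_def using pos by (intro mult_left_mono) auto
    show "0 \<le> D1" unfolding D1_def using pos by (intro mult_nonneg_nonneg) auto
    have "S * M \<le> S * (3 * P)" using pos by (intro mult_left_mono) auto
    then show "D2 \<le> 3 * W" unfolding D2_def W_def by (simp add: mult.commute mult.left_commute)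
  qed
  have three': "2 * (k * (D2 - 2 * E2)) \<le> 2 * T 3"
  proof -
    have "2 * (D2 - 2 * E2) = S * (M - P)" using E12(2) unfolding D2_def W_def by (simp add: algebra_simps)
    then have "2 * (k * (D2 - 2 * E2)) = k * (S * (M - P))" by algebra
    then show ?thesis using three unfolding S_def by linarith
  qed
  have four': "k * (D2 - E2) \<le> 2 * T 3 + T 2"
  proof -
    have "4 * (D2 - E2) = S * (3 * M - P)" using E12(2) unfolding D2_def W_def by (simp add: algebra_simps)
    then have eq: "4 * (k * (D2 - E2)) = k * (S * (3 * M - P))" by algebra
    have "4 * (k * (D2 - E2)) \<le> 4 * (2 * T 3 + T 2)" unfolding eq S_def by (rule four)
    then show ?thesis by simp
  qed
  have "edge_split {1..q'} D E T"
  proof (cases "M \<le> P")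
    case True
    \<comment> \<open>For \<open>m = 4\<close> this is where \<open>r = 1\<close> has to be excluded.\<close>
    have small: "2 \<le> S \<or> 8 \<le> M"
    proof (cases "s = 1")
      case True
      then have "r = 1" using rs by simp
      then have "4 dvd m" "m \<noteq> 4" using dvd4 exc by auto
      then have "8 \<le> m" using m4 by presburger
      then show ?thesis by (simp add: M_def)
    qed (use rs in \<open>simp add: S_def\<close>)
    have "D2 \<le> W" unfolding D2_def W_def using True pos by (simp add: mult.commute)
    then have below: "D1 - 2 * E1 \<le> 0" "D2 - 2 * E2 \<le> 0" using E12 D12 by linarith+
    show ?thesis
    proof (rule edge_split_two_sizes[OF q D E, folded k_def Q_def Q'_def])
      show "Q * max 0 (D1 - 2 * E1) + k * max 0 (D2 - 2 * E2) \<le> T 3"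
        using below Tnn[of 3] by (simp add: max_absorb1)
      show "Q * max 0 (D1 - E1) + k * max 0 (D2 - E2) \<le> 2 * T 3 + T 2"
      proof (cases "D1 \<le> E1")
        case True
        then show ?thesis using four' Tnn[of 2] Tnn[of 3] by (cases "D2 \<le> E2") (auto simp: max_def)
      next
        case False
        then have "E2 < D2" using E12 D12 by linarith
        then have "Q * max 0 (D1 - E1) + k * max 0 (D2 - E2) = (Q * D1 + k * D2) - (Q * E1 + k * E2)"
          using False by (simp add: max_def algebra_simps)
        then show ?thesis unfolding sumD sumE using Tnn[of 0] by simp
      qed
      have "2 * N3 \<le> S * (Y1 + Y2)"
        using small
      proof
        assume "2 \<le> S"
        have "2 * N3 \<le> 2 * (Y1 + Y2)"
          unfolding N3_def Y1_def Y2_def using pos True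
          by (intro mult_left_mono cubic_le_types_12) auto
        also have "\<dots> \<le> S * (Y1 + Y2)" using \<open>2 \<le> S\<close> Ynn by (intro scale) auto
        finally show ?thesis .
      next
        assume "8 \<le> M"
        then have "2 * N3 \<le> 1 * (Y1 + Y2)"
          unfolding N3_def Y1_def Y2_def mult_1 using pos True by (intro cubic_le_types_12_large) auto
        also have "\<dots> \<le> S * (Y1 + Y2)" using pos Ynn by (intro scale) auto
        finally show ?thesis .
      qed
      from few_colors[OF this] have "2 * (6 * Q') \<le> 6 * T 1 + 3 * (4 * T 2)"
        unfolding T1 T2 Y1_def Y2_def by (simp add: algebra_simps)
      then show "T 3 = 0 \<or> 2 * Q' \<le> T 1 + 2 * T 2" by simp
      show "Q' \<le> T 1 \<or> even D1 \<and> even D2 \<and> T 3 \<le> T 1"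
      proof (cases "even D1 \<and> even D2")
        case True
        have "(M - 1) * (M - 2) \<le> (P - 1) * (P - 2)"
          using pos \<open>M \<le> P\<close> by (intro mult_mono) auto
        then have "L * (M * P) * ((M - 1) * (M - 2)) \<le> L * (M * P) * ((P - 1) * (P - 2))"
          using pos by (intro mult_left_mono) auto
        then have "6 * T 3 \<le> 6 * T 1" unfolding T1 T3 by (simp add: mult.assoc mult.commute mult.left_commute)
        then show ?thesis using True by simp
      next
        case False
        then have "odd M" "odd S \<or> odd (S - R)" by (auto simp: D1_def D2_def)
        then have "odd m" by (simp add: M_def)
        then have "4 dvd r" by (rule r4)
        then have "4 \<le> r" "even R" using rs by (auto simp: R_def dest: dvd_imp_le elim: dvd_trans[rotated])
        then have "odd S" using \<open>odd S \<or> odd (S - R)\<close> by auto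
        then have "5 \<le> S" using \<open>4 \<le> r\<close> rs by (cases "s = 4") (auto simp: S_def)
        have "N3 \<le> 5 * Y1" unfolding N3_def Y1_def using pos \<open>M \<le> P\<close> by (intro cubic_le_types_1) auto
        also have "\<dots> \<le> S * Y1" using \<open>5 \<le> S\<close> Ynn by (intro scale) auto
        finally have "1 * N3 \<le> S * Y1" by simp
        from few_colors[OF this] have "6 * Q' \<le> 6 * T 1" unfolding T1 Y1_def by simp
        then show ?thesis by simp
      qed
      show "(if odd (max 0 (D1 - E1)) then Q else 0) + (if odd (max 0 (D2 - E2)) then k else 0) \<le> T 2"
      proof (cases "P \<le> 3 * M")
        case True
        have "2 * N3 \<le> S * Y2"
          using small
        proof
          assume "2 \<le> S"
          then have "2 * Y2 \<le> S * Y2" using Ynn by (intro scale) auto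
          moreover have "N3 \<le> Y2"
            unfolding N3_def Y2_def using pos True \<open>M \<le> P\<close> by (intro cubic_le_types_2) auto
          ultimately show ?thesis by linarith
        next
          assume "8 \<le> M"
          then have "2 * N3 \<le> Y2"
            unfolding N3_def Y2_def using pos True \<open>M \<le> P\<close> by (intro cubic_le_types_2_large) auto
          moreover have "1 * Y2 \<le> S * Y2" using pos Ynn by (intro scale) auto
          ultimately show ?thesis by linarith
        qed
        from few_colors[OF this] have "2 * (6 * Q') \<le> 3 * (4 * T 2)"
          unfolding T2 Y2_def by (simp add: algebra_simps)
        then show ?thesis using kQ pos by auto
      next
        case False
        have "S * (3 * M) \<le> S * P" using False pos by (intro mult_left_mono) auto
        then have "3 * D2 \<le> W" unfolding D2_def W_def by (simp add: algebra_simps)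
        then have "D1 - E1 \<le> 0" "D2 - E2 \<le> 0" using E12 D12 by linarith+
        then show ?thesis using Tnn[of 2] by (simp add: max_absorb1)
      qed
    qed (use D12 E12 sumD sumE in auto)
  next
    case False
    then have "r \<noteq> s" using two(1) m4 by (auto simp: M_def P_def)
    then have S2: "2 \<le> S" using rs by (simp add: S_def)
    have P2: "2 \<le> P" using pos by linarith
    have "W < D2" unfolding D2_def W_def using False pos by (simp add: mult.commute)
    then have above: "E2 - D2 \<le> 0" "2 * E2 - D2 \<le> 0" using E12 D12 by linarith+
    have "edge_split {1..q'} (\<lambda>j. 3 * E j - D j) E (\<lambda>a. T (3 - a))"
    proof (rule edge_split_two_sizes[OF q, of _ "3 * E1 - D1" "3 * E2 - D2" _ E1 E2,
          folded k_def Q_def Q'_def])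
      show "3 * E j - D j = (if j \<le> q then 3 * E1 - D1 else 3 * E2 - D2)" for j
        unfolding D E by simp
      show "E j = (if j \<le> q then E1 else E2)" for j by (rule E)
      show "0 \<le> 3 * E1 - D1" "0 \<le> 3 * E2 - D2" using E12 D12 by linarith+
      show "3 * E1 - D1 \<le> 3 * E1" "3 * E2 - D2 \<le> 3 * E2" using D12 by linarith+
      show "Q * E1 + k * E2 = T (3 - 0) + T (3 - 1) + T (3 - 2) + T (3 - 3)"
        using sumE by simp
      show "Q * (3 * E1 - D1) + k * (3 * E2 - D2) = T (3 - 1) + 2 * T (3 - 2) + 3 * T (3 - 3)"
        using sumE sumD by (simp add: algebra_simps)
      show "Q * max 0 (3 * E1 - D1 - 2 * E1) + k * max 0 (3 * E2 - D2 - 2 * E2) \<le> T (3 - 3)"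
      proof (cases "E1 \<le> D1")
        case True
        then show ?thesis using above Tnn[of 0] by (simp add: max_absorb1)
      next
        case False
        then have "Q * max 0 (3 * E1 - D1 - 2 * E1) + k * max 0 (3 * E2 - D2 - 2 * E2) =
            (Q * E1 + k * E2) - (Q * D1 + k * D2) + k * (D2 - E2)"
          using above by (simp add: max_def algebra_simps)
        also have "\<dots> \<le> T 0" unfolding sumE sumD using four' Tnn[of 2] Tnn[of 3] by simp
        finally show ?thesis by simp
      qed
      show "Q * max 0 (3 * E1 - D1 - E1) + k * max 0 (3 * E2 - D2 - E2) \<le> 2 * T (3 - 3) + T (3 - 2)"
      proof (cases "2 * E1 \<le> D1")
        case True
        then show ?thesis using above Tnn[of 0] Tnn[of 1] by (simp add: max_absorb1)
      next
        case False
        then have "Q * max 0 (3 * E1 - D1 - E1) + k * max 0 (3 * E2 - D2 - E2) =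
            2 * (Q * E1 + k * E2) - (Q * D1 + k * D2) + k * (D2 - 2 * E2)"
          using above by (simp add: max_def algebra_simps)
        also have "\<dots> \<le> 2 * T 0 + T 1" unfolding sumE sumD using three' by simp
        finally show ?thesis by simp
      qed
      \<comment> \<open>With fewer than four new vertices there are no edges of type 0, and two of the rounding
        conditions hold trivially.\<close>
      have big_P: "4 \<le> P" if "T 0 \<noteq> 0"
      proof (rule ccontr)
        assume "\<not> 4 \<le> P"
        then have "P = 2 \<or> P = 3" using P2 by auto
        then have "24 * T 0 = 0" unfolding T0 by auto
        then show False using that by simp
      qed
      show "T (3 - 3) = 0 \<or> 2 * Q' \<le> T (3 - 1) + 2 * T (3 - 2)"
      proof (cases "T 0 = 0")
        case False
        have "4 * N3 \<le> 2 * (4 * Y1 + Y2)"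
          using cubic_le_types_12_short[of P M] big_P[OF False] \<open>\<not> M \<le> P\<close> pos
          unfolding N3_def Y1_def Y2_def by simp
        also have "\<dots> \<le> S * (4 * Y1 + Y2)" using S2 Ynn by (intro scale) auto
        finally have "4 * N3 \<le> S * (4 * Y1 + Y2)" .
        from few_colors[OF this] have "4 * (6 * Q') \<le> 4 * (6 * T 1) + 3 * (4 * T 2)"
          unfolding T1 T2 Y1_def Y2_def by (simp add: algebra_simps)
        then show ?thesis by simp
      qed simp
      have "2 * N3 \<le> S * Y2"
      \<comment> \<open>The estimate fails for \<open>m = 6\<close>, \<open>p = 2\<close>, but there \<open>r\<close> is even and so \<open>s \<ge> 3\<close>.\<close>
      proof (cases "M = 6 \<and> P = 2")
        case True
        then have "m = 6" by (simp add: M_def)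
        then have "even r" using dvd4(1) by presburger
        then have "3 \<le> S" using rs \<open>r \<noteq> s\<close> by (cases "r = 1") (auto simp: S_def)
        then have "3 * Y2 \<le> S * Y2" using Ynn by (intro scale) auto
        then show ?thesis using True by (simp add: N3_def Y2_def)
      next
        case False
        have "N3 \<le> Y2"
        proof (cases "4 \<le> P")
          case True
          then have "(P + M - 1) * (P + M - 2) * (P + M - 3) \<le> 3 * P * (P - 1) * M * (M - 1)"
            using \<open>\<not> M \<le> P\<close> pos by (intro cubic_le_types_2) auto
          moreover have "(P + M - 1) * (P + M - 2) * (P + M - 3) = N3"
            and "3 * P * (P - 1) * M * (M - 1) = Y2"
            unfolding N3_def Y2_def by algebra+
          ultimately show ?thesis by (simp only:)
        next
          case False
          have "4 \<le> M" "M \<le> 3 * P" using pos by auto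
          from False P2 consider "P = 2" | "P = 3" by linarith
          then show ?thesis
          proof cases
            case 1
            then have "M = 4 \<or> M = 5"
              using \<open>4 \<le> M\<close> \<open>M \<le> 3 * P\<close> \<open>\<not> (M = 6 \<and> P = 2)\<close> by presburger
            then show ?thesis using 1 by (auto simp: N3_def Y2_def)
          next
            case 2
            then have "M = 4 \<or> M = 5 \<or> M = 6 \<or> M = 7 \<or> M = 8 \<or> M = 9"
              using \<open>4 \<le> M\<close> \<open>M \<le> 3 * P\<close> by presburger
            then show ?thesis using 2 by (auto simp: N3_def Y2_def)
          qed
        qed
        moreover have "2 * Y2 \<le> S * Y2" using S2 Ynn by (intro scale) auto
        ultimately show ?thesis by linarith
      qed
      from few_colors[OF this] have "2 * (6 * Q') \<le> 3 * (4 * T 2)"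
        unfolding T2 Y2_def by (simp add: algebra_simps)
      then show "Q' \<le> T (3 - 1) \<or> even (3 * E1 - D1) \<and> even (3 * E2 - D2) \<and> T (3 - 3) \<le> T (3 - 1)"
        by simp
      show "(if odd (max 0 (3 * E1 - D1 - E1)) then Q else 0) +
          (if odd (max 0 (3 * E2 - D2 - E2)) then k else 0) \<le> T (3 - 2)"
        if "0 < T (3 - 3)"
      proof -
        have P4: "4 \<le> P" using that by (intro big_P) simp
        have "Q \<le> T 1" if "odd D1"
        proof -
          have "odd m" using that by (simp add: D1_def M_def)
          then have "4 dvd r" by (rule r4)
          then have "4 \<le> R" using rs by (auto simp: R_def dest: dvd_imp_le)
          have "M3 \<le> 4 * Y1"
            unfolding M3_def Y1_def using P4 pos by (intro cubic_le_types_1_short) auto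
          also have "\<dots> \<le> R * Y1" using \<open>4 \<le> R\<close> Ynn by (intro mult_right_mono) auto
          finally have "L * M3 \<le> L * (R * Y1)" using pos by (intro mult_left_mono) auto
          then have "R * (6 * Q) \<le> R * (6 * T 1)"
            unfolding T1 using rq6 by (simp add: Y1_def algebra_simps)
          then show ?thesis using pos by simp
        qed
        moreover have "odd D1" if "odd (max 0 (3 * E1 - D1 - E1))"
          using that by (auto simp: max_def split: if_splits)
        moreover have "max 0 (3 * E2 - D2 - E2) = 0" using above by simp
        ultimately show ?thesis using Tnn[of 1] by auto
      qed
    qed
    then show ?thesis by (rule edge_split_reverse)
  qed
  then show ?thesis by (simp add: D_def E_def)
qed

text \<open>
  Each new color has \<open>e j 3 \<ge> D j - 2 * E j\<close> and \<open>2 * e j 3 + e j 2 \<ge> D j - E j\<close>, and its new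
  edges suffice for \<open>[m]\<close> only if \<open>D j \<le> 3 * E j\<close>. If \<open>s = r\<close>, an old color has only new edges of
  type 0, and \<open>T 0\<close> provides enough of them only if \<open>m \<le> n - m\<close>.
\<close>

lemma conditions_if_edge_split:
  fixes m n r s lam q q' :: nat
  defines "M \<equiv> int m" and "P \<equiv> int n - int m" and "k \<equiv> int q' - int q" and "T \<equiv> edge_types lam m n"
  assumes m4: "4 \<le> m" "m < n" and pos: "1 \<le> lam" "1 \<le> s" "r \<le> s"
    and dvd4: "4 dvd r * m" "4 dvd s * n"
    and rq: "r * q = lam * ((m - 1) choose 3)"
    and q: "q < q'"
    and split: "edge_split {1..q'} (\<lambda>j. int (missing_degree r s q j * m)) (color_size r s m n q) T"
  shows "s = r \<Longrightarrow> 2 * m \<le> n" and "4 * m \<le> 3 * n"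
    and "k * (int s * (M - P)) \<le> 2 * T 3"
    and "k * (int s * (3 * M - P)) \<le> 4 * (2 * T 3 + T 2)"
proof -
  define S W where "S = int s" and "W = S * P"
  obtain e :: "nat \<Rightarrow> nat \<Rightarrow> nat"
    where eE: "\<And>j. j \<in> {1..q'} \<Longrightarrow> (\<Sum>a\<le>3. int (e j a)) = color_size r s m n q j"
    and eD: "\<And>j. j \<in> {1..q'} \<Longrightarrow> (\<Sum>a\<le>3. int a * int (e j a)) = int (missing_degree r s q j * m)"
    and eT: "\<And>a. a \<le> 3 \<Longrightarrow> (\<Sum>j\<in>{1..q'}. int (e j a)) = T a"
    using split unfolding edge_split_def by blast
  have W: "int (s * (n - m)) = W" using m4 by (simp add: W_def S_def P_def of_nat_diff)
  have E4: "4 * color_size r s m n q j = int (missing_degree r s q j * m) + W" for j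
    using color_size_times_4[of m n r s q j] m4 pos dvd4 W by simp
  have e: "4 * int (e j 0) + 4 * int (e j 1) + 4 * int (e j 2) + 4 * int (e j 3) = int (missing_degree r s q j * m) + W"
    "int (e j 1) + 2 * int (e j 2) + 3 * int (e j 3) = int (missing_degree r s q j * m)"
    if "j \<in> {1..q'}" for j
    using eE[OF that] eD[OF that] E4[of j] by (simp_all add: sum_upto_3)
  have bounds: "d - W \<le> 2 * int (e j 3)" "3 * d - W \<le> 8 * int (e j 3) + 4 * int (e j 2)"
      "d \<le> 3 * W" "d = 0 \<Longrightarrow> W = 4 * int (e j 0)"
    if "j \<in> {1..q'}" "d = int (missing_degree r s q j * m)" for j d
    using e[OF that(1), folded that(2)] by linarith+
  have new: "int (missing_degree r s q j * m) = S * M" if "j \<in> {q+1..q'}" for j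
    using that by (simp add: missing_degree_def S_def M_def)
  have part: "(\<Sum>j\<in>{q+1..q'}. int (e j a)) \<le> T a" if "a \<le> 3" for a
    unfolding eT[OF that, symmetric] by (intro sum_mono2) auto
  have kS: "(\<Sum>j\<in>{q+1..q'}. c) = k * c" for c :: int
    using q by (simp add: k_def of_nat_diff)
  have "k * (S * (M - P)) = (\<Sum>j\<in>{q+1..q'}. S * M - W)"
    unfolding kS by (simp add: W_def algebra_simps)
  also have "\<dots> \<le> (\<Sum>j\<in>{q+1..q'}. 2 * int (e j 3))"
  proof (rule sum_mono)
    fix j assume j: "j \<in> {q+1..q'}"
    then have "j \<in> {1..q'}" by auto
    then show "S * M - W \<le> 2 * int (e j 3)" using new[OF j] by (intro bounds(1)) auto
  qed
  also have "\<dots> \<le> 2 * T 3" using part[of 3] by (simp flip: sum_distrib_left)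
  finally show "k * (int s * (M - P)) \<le> 2 * T 3" by (simp only: S_def)
  have "k * (S * (3 * M - P)) = (\<Sum>j\<in>{q+1..q'}. 3 * (S * M) - W)"
    unfolding kS by (simp add: W_def algebra_simps)
  also have "\<dots> \<le> (\<Sum>j\<in>{q+1..q'}. 8 * int (e j 3) + 4 * int (e j 2))"
  proof (rule sum_mono)
    fix j assume j: "j \<in> {q+1..q'}"
    then have "j \<in> {1..q'}" by auto
    then show "3 * (S * M) - W \<le> 8 * int (e j 3) + 4 * int (e j 2)"
      using new[OF j] by (intro bounds(2)) auto
  qed
  also have "\<dots> \<le> 4 * (2 * T 3 + T 2)"
    using part[of 3] part[of 2] by (simp add: sum.distrib flip: sum_distrib_left)
  finally show "k * (int s * (3 * M - P)) \<le> 4 * (2 * T 3 + T 2)" by (simp only: S_def)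
  have "q' \<in> {1..q'}" "q' \<in> {q+1..q'}" using q by auto
  then have "S * M \<le> 3 * W" using new[of q'] by (intro bounds(3)[of q']) auto
  then have "S * M \<le> S * (3 * P)" by (simp add: W_def algebra_simps)
  then show "4 * m \<le> 3 * n" using pos by (simp add: S_def M_def P_def)
  show "2 * m \<le> n" if "s = r"
  proof (rule ccontr)
    assume "\<not> 2 * m \<le> n"
    then have PM: "P < M" "1 \<le> P" "4 \<le> M" using m4 by (auto simp: P_def M_def)
    have "int q * W = (\<Sum>j\<in>{1..q}. W)" by simp
    also have "\<dots> = (\<Sum>j\<in>{1..q}. 4 * int (e j 0))"
    proof (rule sum.cong[OF refl])
      fix j assume j: "j \<in> {1..q}"
      then have "int (missing_degree r s q j * m) = 0" using that by (simp add: missing_degree_def)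
      moreover have "j \<in> {1..q'}" using j q by auto
      ultimately show "W = 4 * int (e j 0)" by (intro bounds(4)[of j 0]) auto
    qed
    also have "\<dots> \<le> (\<Sum>j\<in>{1..q'}. 4 * int (e j 0))" using q by (intro sum_mono2) auto
    also have "\<dots> = 4 * T 0" unfolding eT[OF le0, symmetric] by (rule sum_distrib_left[symmetric])
    finally have "6 * (int q * W) \<le> 24 * T 0" by linarith
    moreover have "24 * T 0 = int lam * (P * (P - 1) * (P - 2) * (P - 3))"
      using edge_types_polynomials(4)[of m n lam] m4 by (simp add: T_def P_def)
    moreover have "6 * (int q * W) = int lam * (P * ((M - 1) * (M - 2) * (M - 3)))"
    proof -
      have "6 * (int r * int q) = int lam * (6 * int ((m - 1) choose 3))"
        by (metis mult.left_commute of_nat_mult rq)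
      then have "6 * (int r * int q) = int lam * ((M - 1) * (M - 2) * (M - 3))"
        unfolding int_choose_3 using m4 by (simp add: M_def of_nat_diff)
      moreover have "6 * (int q * W) = P * (6 * (int r * int q))" by (simp add: W_def S_def that)
      ultimately show ?thesis by simp
    qed
    ultimately have "int lam * (P * ((M - 1) * (M - 2) * (M - 3))) \<le> int lam * (P * ((P - 1) * (P - 2) * (P - 3)))"
      by (simp add: mult.assoc)
    then have le: "(M - 1) * (M - 2) * (M - 3) \<le> (P - 1) * (P - 2) * (P - 3)"
      using pos PM by simp
    show False
    proof (cases "4 \<le> P")
      case True
      have "(P - 1) * (P - 2) < (M - 1) * (M - 2)" using PM True by (intro mult_strict_mono) auto
      then have "(P - 1) * (P - 2) * (P - 3) < (M - 1) * (M - 2) * (M - 3)"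
        using PM True by (intro mult_strict_mono) auto
      then show False using le by simp
    next
      case False
      then have "P = 1 \<or> P = 2 \<or> P = 3" using PM by presburger
      then have "(P - 1) * (P - 2) * (P - 3) = 0" by auto
      moreover have "0 < (M - 1) * (M - 2) * (M - 3)" using PM by (intro mult_pos_pos) auto
      ultimately show False using le by linarith
    qed
  qed
qed

text \<open>
  Multiplied by \<open>lam\<close>, the second factor on the smaller side of these inequalities
  becomes \<open>s * k\<close>, where \<open>k\<close> is the number of new colors.
\<close>

lemma real_conditions:
  fixes m n r s lam q q' :: nat
  defines "B \<equiv> real ((n - 1) choose 3) - real s / real r * real ((m - 1) choose 3)"
    and "M \<equiv> int m" and "P \<equiv> int n - int m" and "k \<equiv> int q' - int q" and "T \<equiv> edge_types lam m n"
  assumes mn: "m < n" and lam: "1 \<le> lam" and r: "1 \<le> r"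
    and rq: "r * q = lam * ((m - 1) choose 3)" and sq: "s * q' = lam * ((n - 1) choose 3)"
  shows "(real n - real m) * real (m choose 3) \<ge> (real m - real n / 2) * B \<longleftrightarrow>
      k * (int s * (M - P)) \<le> 2 * T 3"
    and "2 * (real n - real m) * real (m choose 3) + real (m choose 2) * real ((n - m) choose 2)
        \<ge> (real m - real n / 4) * B \<longleftrightarrow>
      k * (int s * (3 * M - P)) \<le> 4 * (2 * T 3 + T 2)"
proof -
  have sq': "real lam * real ((n - 1) choose 3) = real s * real q'" by (metis of_nat_mult sq)
  have rq': "real lam * real ((m - 1) choose 3) = real r * real q" by (metis of_nat_mult rq)
  have "real lam * B = real lam * real ((n - 1) choose 3) - real s / real r * (real lam * real ((m - 1) choose 3))"
    by (simp add: B_def algebra_simps)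
  also have "\<dots> = real s * of_int k" unfolding sq' rq' using r by (simp add: k_def field_simps)
  finally have B: "real lam * B = real s * of_int k" .
  have T3: "real_of_int (T 3) = real lam * ((real n - real m) * real (m choose 3))"
    using mn by (simp add: T_def edge_types_def of_nat_diff)
  have T2: "real_of_int (T 2) = real lam * (real (m choose 2) * real ((n - m) choose 2))"
    by (simp add: T_def edge_types_def)
  have iff: "y \<le> x \<longleftrightarrow> b \<le> a"
    if "real_of_int a = c * (real lam * x)" "real_of_int b = c * (real lam * y)" "0 < c"
    for x y c :: real and a b :: int
  proof -
    have "b \<le> a \<longleftrightarrow> real_of_int b \<le> real_of_int a" by simp
    also have "\<dots> \<longleftrightarrow> (c * real lam) * y \<le> (c * real lam) * x"
      unfolding that(1,2) by (simp only: mult.assoc)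
    also have "\<dots> \<longleftrightarrow> y \<le> x" using that(3) lam by (intro mult_le_cancel_left_pos) auto
    finally show ?thesis by simp
  qed
  show "(real n - real m) * real (m choose 3) \<ge> (real m - real n / 2) * B \<longleftrightarrow>
      k * (int s * (M - P)) \<le> 2 * T 3"
  proof (rule iff[where c = 2])
    show "real_of_int (k * (int s * (M - P))) = 2 * (real lam * ((real m - real n / 2) * B))"
    proof -
      have "2 * (real lam * ((real m - real n / 2) * B)) = (2 * real m - real n) * (real lam * B)"
        by (simp add: algebra_simps)
      then show ?thesis unfolding B by (simp add: M_def P_def algebra_simps)
    qed
  qed (simp_all add: T3)
  show "2 * (real n - real m) * real (m choose 3) + real (m choose 2) * real ((n - m) choose 2)
        \<ge> (real m - real n / 4) * B \<longleftrightarrow>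
      k * (int s * (3 * M - P)) \<le> 4 * (2 * T 3 + T 2)"
  proof (rule iff[where c = 4])
    show "real_of_int (k * (int s * (3 * M - P))) = 4 * (real lam * ((real m - real n / 4) * B))"
    proof -
      have "4 * (real lam * ((real m - real n / 4) * B)) = (4 * real m - real n) * (real lam * B)"
        by (simp add: algebra_simps)
      then show ?thesis unfolding B by (simp add: M_def P_def algebra_simps)
    qed
  qed (simp_all add: T3 T2 algebra_simps)
qed

theorem theorem1p1:
  fixes m n r s lam q :: nat and f :: "edge \<Rightarrow> nat"
  assumes "r \<ge> 1" and "s \<ge> 1" and "lam \<ge> 1"
    and "n > m" and "m \<ge> 4"
    and "m = 4 \<Longrightarrow> lam \<ge> 2 \<and> r \<ge> 2"
    and "r * ((n - 1) choose 3) > s * ((m - 1) choose 3)"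
    and "factorization r lam m 4 q f"
  shows "extends_to_factorization s lam n m 4 q f \<longleftrightarrow>
    (4 dvd r * m \<and> 4 dvd s * n \<and>
     r dvd lam * ((m - 1) choose 3) \<and> s dvd lam * ((n - 1) choose 3) \<and>
     1 \<le> real s / real r \<and>
     real s / real r \<le> real ((n - 1) choose 3) / real ((m - 1) choose 3)) \<and>
    ((s = r \<longrightarrow> n \<ge> 2 * m) \<and> (s > r \<longrightarrow> real n \<ge> 4 * real m / 3)) \<and>
    (real n - real m) * real (m choose 3)
       \<ge> (real m - real n / 2) *
           (real ((n - 1) choose 3) - real s / real r * real ((m - 1) choose 3)) \<and>
    2 * (real n - real m) * real (m choose 3) + real (m choose 2) * real ((n - m) choose 2)
       \<ge> (real m - real n / 4) *
           (real ((n - 1) choose 3) - real s / real r * real ((m - 1) choose 3))"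
  (is "_ \<longleftrightarrow> ?one \<and> ?two \<and> ?three \<and> ?four")
proof -
  note r = assms(1) and s = assms(2) and lam = assms(3) and mn = assms(4) and m4 = assms(5)
    and exc = assms(6) and more = assms(7) and fac = assms(8)
  have rq: "r * q = lam * ((m - 1) choose 3)"
    using factorization_color_count[OF fac] m4 by simp
  have Cm: "0 < (m - 1) choose 3" using m4 by (simp add: zero_less_binomial)
  have "0 < r * q" unfolding rq using lam Cm by simp
  then have q1: "1 \<le> q" by simp
  have dvd4m: "4 dvd r * m" using factorization_dvd[OF fac q1] .
  have q_less: "q < q'" if "s * q' = lam * ((n - 1) choose 3)" for q'
  proof -
    have "s * (r * q) = lam * (s * ((m - 1) choose 3))" unfolding rq by simp
    also have "\<dots> < lam * (r * ((n - 1) choose 3))" using more lam by simp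
    also have "\<dots> = r * (s * q')" unfolding that by simp
    finally show ?thesis using r s by simp
  qed
  show ?thesis
  proof
    assume "extends_to_factorization s lam n m 4 q f"
    then obtain q' g where "{1..q} \<subseteq> {1..q'}" and facg: "factorization s lam n 4 q' g"
      and ext: "\<And>p. p \<in> complete_edges lam m 4 \<Longrightarrow> g p = f p"
      unfolding extends_to_factorization_def by blast
    then have qq: "q \<le> q'" using q1 by auto
    note split = edge_split_of_extension[OF _ mn q1 qq fac facg ext]
    have rs: "r \<le> s" using split(1) m4 by simp
    have sq: "s * q' = lam * ((n - 1) choose 3)"
      using factorization_color_count[OF facg] m4 mn by simp
    have dvd4n: "4 dvd s * n" using factorization_dvd[OF facg] q1 qq by simp
    have edges: "edge_split {1..q'} (\<lambda>j. int (missing_degree r s q j * m)) (color_size r s m n q)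
        (edge_types lam m n)"
      using split(2) m4 by simp
    note conds = conditions_if_edge_split[OF m4 mn lam s rs dvd4m dvd4n rq q_less[OF sq] edges]
    have ?one
    proof (intro conjI)
      show "r dvd lam * ((m - 1) choose 3)" unfolding rq[symmetric] by simp
      show "s dvd lam * ((n - 1) choose 3)" unfolding sq[symmetric] by simp
      show "1 \<le> real s / real r" using rs r by simp
      have "real s * real ((m - 1) choose 3) \<le> real ((n - 1) choose 3) * real r"
        using more by (metis less_imp_le mult.commute of_nat_le_iff of_nat_mult)
      then show "real s / real r \<le> real ((n - 1) choose 3) / real ((m - 1) choose 3)"
        using r Cm by (simp add: frac_le_eq field_simps)
    qed (use dvd4m dvd4n in auto)
    moreover have ?two using conds(1,2) by auto
    ultimately show "?one \<and> ?two \<and> ?three \<and> ?four"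
      using conds(3,4) real_conditions[OF mn lam r rq sq] by blast
  next
    assume conds: "?one \<and> ?two \<and> ?three \<and> ?four"
    then have "s dvd lam * ((n - 1) choose 3)" by blast
    then obtain q' where sq: "s * q' = lam * ((n - 1) choose 3)" by (metis dvd_def)
    have rs: "r \<le> s" using conds r by simp
    have qq: "q \<le> q'" using q_less[OF sq] by simp
    have two: "s = r \<Longrightarrow> 2 * m \<le> n" "4 * m \<le> 3 * n"
    proof -
      show "s = r \<Longrightarrow> 2 * m \<le> n" using conds by blast
      show "4 * m \<le> 3 * n"
      proof (cases "s = r")
        case True
        then show ?thesis using conds by linarith
      next
        case False
        then have "real n \<ge> 4 * real m / 3" using conds rs by simp
        then show ?thesis by simp
      qed
    qed
    have dvd4n: "4 dvd s * n" using conds by blast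
    have edges: "edge_split {1..q'} (\<lambda>j. int (missing_degree r s q j * m)) (color_size r s m n q)
        (edge_types lam m n)"
      using edge_split_if_conditions[OF m4 mn r rs _ dvd4m dvd4n rq sq qq two] exc conds
        real_conditions[OF mn lam r rq sq] by blast
    show "extends_to_factorization s lam n m 4 q f"
      using extension_if_edge_split[OF mn fac rs qq edges] color_size_times_4[OF _ rs dvd4m dvd4n] mn
      by simp
  qed
qed

end
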